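(* Let $A, B, C$ be positive integers with $C\in\{1,2,4\}$ such that: $A$ is square-free; $AB$ is not a perfect square; if $C$ is even then $AB$ is odd; and if $A=1$ then $C=2$. Assume that the equation $Az_1^2-Bz_2^2=C$ has a solution in positive integers $z_1,z_2$, and let $(z_1,z_2)=(a,b)$ be its smallest solution in positive integers. If the quantity $\dfrac{4}{C}Bb^2+3$ is not a perfect square, then the equation $$Ax^2-By^4=C$$ has at most one solution in positive integers $x$ and $y$.
   Context: The smallest solution in positive integers of $Az_1^2-Bz_2^2=C$ is the solution $(a,b)$ with $a,b$ positive integers for which $a$ (equivalently $b$) is minimal. *)

theory Defs
  imports
    Complex_Main
    "HOL-Computational_Algebra.Squarefree"
    "HOL-Computational_Algebra.Nth_Powers"
begin

definition quadratic_solution :: "int \<Rightarrow> int \<Rightarrow> int \<Rightarrow> int \<Rightarrow> int \<Rightarrow> bool" where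
  "quadratic_solution A B C z1 z2 \<longleftrightarrow> z1 > 0 \<and> z2 > 0 \<and> A * z1\<^sup>2 - B * z2\<^sup>2 = C"

(* For A, B > 0 the first component of a positive solution strictly increases with the
   second, so minimality of the first is the same as minimality of the second. *)
definition smallest_quadratic_solution :: "int \<Rightarrow> int \<Rightarrow> int \<Rightarrow> int \<Rightarrow> int \<Rightarrow> bool" where
  "smallest_quadratic_solution A B C a b \<longleftrightarrow>
     quadratic_solution A B C a b \<and> (\<forall>z1 z2. quadratic_solution A B C z1 z2 \<longrightarrow> a \<le> z1)"

definition quartic_solution :: "int \<Rightarrow> int \<Rightarrow> int \<Rightarrow> int \<Rightarrow> int \<Rightarrow> bool" where
  "quartic_solution A B C x y \<longleftrightarrow> x > 0 \<and> y > 0 \<and> A * x\<^sup>2 - B * y ^ 4 = C"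

end

theory Submission
  imports Defs "HOL-Number_Theory.Quadratic_Reciprocity"
begin

text \<open>Let \<open>t = (a \<surd>A + b \<surd>B) / \<surd>C\<close> and \<open>P = t\<^sup>2 + t\<^sup>-\<^sup>2 = 2 + 4 B b\<^sup>2 / C\<close>. All positive solutions of
  \<open>A x\<^sup>2 - B z\<^sup>2 = C\<close> come from odd powers \<open>t\<^sup>k\<close>, with \<open>z = b W\<^sub>k\<close> for the Lehmer numbers
  \<open>W\<^sub>k = (t\<^sup>k - t\<^sup>-\<^sup>k) / (t - t\<^sup>-\<^sup>1)\<close>. Two quartic solutions make \<open>W\<^sub>m W\<^sub>n\<close> a square; dividing by the
  common factor \<open>W\<^sub>d\<close>, \<open>d = gcd m n\<close>, leaves two coprime Lehmer numbers of \<open>t\<^sup>d\<close>, which are both squares.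

  The core is that \<open>W\<^sub>k\<close>, \<open>k\<close> odd, is a square only for \<open>k \<in> {1, 3}\<close>. For most residues of \<open>P\<close> and \<open>k\<close>
  this follows from Jacobi symbols modulo \<open>t\<^sup>2\<^sup>m + t\<^sup>-\<^sup>2\<^sup>m\<close> with \<open>m\<close> a power of \<open>2\<close>. When \<open>P\<close> is even and
  \<open>k = 4 j + 1\<close>, reciprocity gives no contradiction if \<open>k\<close> is a square, as \<open>W\<^sub>k = k\<close> at \<open>t = 1\<close>. There one approximates
  \<open>\<surd>W\<^sub>k = t\<^sup>2\<^sup>j (1 - t\<^sup>-\<^sup>2)\<^sup>-\<^sup>1\<^sup>/\<^sup>2 (1 - t\<^sup>-\<^sup>2\<^sup>k)\<^sup>1\<^sup>/\<^sup>2\<close> by Pade approximants to the square root: for a suitable order this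
  gives an element of \<open>\<int>[t\<^sup>2]\<close> of norm less than \<open>1\<close>, and its vanishing is refuted \<open>2\<close>-adically.
  Finally, the pair \<open>{1, 3}\<close> would make \<open>W\<^sub>3(t\<^sup>d) = t\<^sup>2\<^sup>d + t\<^sup>-\<^sup>2\<^sup>d + 1\<close> a square, which forces \<open>d = 1\<close> and
  \<open>W\<^sub>3(t) = 4 B b\<^sup>2 / C + 3\<close>.\<close>

section \<open>The Jacobi symbol\<close>

text \<open>\<open>prime_factorization\<close> lists the positive primes dividing n, so the sign of
  n is ignored and \<open>Jacobi a 0\<close> is the empty product 1. At even n the extra factors are
  \<open>Legendre a 2\<close>, so this is not the Kronecker symbol.\<close>

definition Jacobi :: "int \<Rightarrow> int \<Rightarrow> int" where
  "Jacobi a n = prod_mset (image_mset (Legendre a) (prime_factorization n))"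

lemma Legendre_cong:
  assumes "[a = b] (mod p)"
  shows "Legendre a p = Legendre b p"
proof -
  have "[a = 0] (mod p) \<longleftrightarrow> [b = 0] (mod p)" "QuadRes p a \<longleftrightarrow> QuadRes p b"
    using assms unfolding QuadRes_def by (meson cong_sym cong_trans)+
  then show ?thesis unfolding Legendre_def by simp
qed

lemma Legendre_values: "Legendre a p \<in> {-1, 0, 1}"
  unfolding Legendre_def by auto

text \<open>Euler's criterion gives the identity modulo p. Both sides lie in {-1, 0, 1}, so their
  difference is at most 2 < p in absolute value and must vanish.\<close>

lemma Legendre_mult:
  fixes p :: int
  assumes p: "prime p" "odd p"
  shows "Legendre (a * b) p = Legendre a p * Legendre b p"
proof -
  have p2: "2 < p" using p prime_ge_2_int[of p] by (cases "p = 2") auto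
  define q where "q = nat p"
  have q: "prime q" "2 < q" "p = int q" using p p2 by (auto simp: q_def)
  have "[Legendre (a*b) p = (a*b)^((q-1) div 2)] (mod p)"
    using euler_criterion[OF q(1,2)] q(3) by auto
  moreover have "[Legendre a p * Legendre b p = a^((q-1) div 2) * b^((q-1) div 2)] (mod p)"
    using euler_criterion[OF q(1,2)] q(3) cong_mult by blast
  ultimately have "[Legendre (a*b) p = Legendre a p * Legendre b p] (mod p)"
    by (metis cong_sym cong_trans power_mult_distrib)
  then have "p dvd Legendre (a*b) p - Legendre a p * Legendre b p"
    by (simp add: cong_iff_dvd_diff)
  moreover have "\<bar>Legendre (a*b) p - Legendre a p * Legendre b p\<bar> < p"
    using Legendre_values[of "a*b" p] Legendre_values[of a p] Legendre_values[of b p] p2 by auto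
  ultimately show ?thesis
    using zdvd_not_zless[of "\<bar>Legendre (a*b) p - Legendre a p * Legendre b p\<bar>" p] by fastforce
qed

lemma Legendre_minus_one:
  fixes p :: int
  assumes p: "prime p" "odd p"
  shows "Legendre (-1) p = (if p mod 4 = 3 then -1 else 1)"
proof -
  have p2: "2 < p" using p prime_ge_2_int[of p] by (cases "p = 2") auto
  define q where "q = nat p"
  have q: "prime q" "2 < q" "p = int q" using p p2 by (auto simp: q_def)
  have e: "[Legendre (-1) p = (-1)^((q-1) div 2)] (mod p)"
    using euler_criterion[OF q(1,2)] q(3) by auto
  have "odd q" using p(2) q(3) by auto
  have m: "(-1::int)^((q-1) div 2) = (if p mod 4 = 3 then -1 else 1)"
  proof (cases "p mod 4 = 3")
    case True
    then have "q mod 4 = 3" using q(3) by presburger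
    then have "q = 4 * (q div 4) + 3" by presburger
    then have "(q - 1) div 2 = 2 * (q div 4) + 1" by linarith
    then have "odd ((q-1) div 2)" by simp
    then show ?thesis using True by simp
  next
    case False
    then have "q mod 4 = 1" using q(3) \<open>odd q\<close> by presburger
    then have "q = 4 * (q div 4) + 1" by presburger
    then have "(q - 1) div 2 = 2 * (q div 4)" by linarith
    then have "even ((q-1) div 2)" by simp
    then show ?thesis using False by simp
  qed
  have "p dvd Legendre (-1) p - (if p mod 4 = 3 then -1 else 1)"
    using e m by (simp add: cong_iff_dvd_diff)
  moreover have "\<bar>Legendre (-1) p - (if p mod 4 = 3 then -1 else 1)\<bar> < p"
    using Legendre_values[of "-1" p] p2 by auto
  ultimately show ?thesis
    using zdvd_not_zless[of "\<bar>Legendre (-1) p - (if p mod 4 = 3 then -1 else 1)\<bar>" p] by fastforce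
qed

lemma Jacobi_one_right [simp]: "Jacobi a 1 = 1"
  by (simp add: Jacobi_def)

lemma Jacobi_mult_right:
  "m \<noteq> 0 \<Longrightarrow> n \<noteq> 0 \<Longrightarrow> Jacobi a (m * n) = Jacobi a m * Jacobi a n"
  by (simp add: Jacobi_def prime_factorization_mult)

lemma Jacobi_prime: "prime p \<Longrightarrow> Jacobi a p = Legendre a p"
  by (simp add: Jacobi_def prime_factorization_prime)

lemma Jacobi_cong:
  assumes "[a = b] (mod n)"
  shows "Jacobi a n = Jacobi b n"
proof -
  have "Legendre a p = Legendre b p" if "p \<in># prime_factorization n" for p
    using that assms by (intro Legendre_cong) (meson cong_dvd_modulus in_prime_factors_imp_dvd)
  then show ?thesis unfolding Jacobi_def by (metis (no_types, lifting) image_mset_cong)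
qed

lemma Jacobi_mult_left:
  assumes "odd n"
  shows "Jacobi (a * b) n = Jacobi a n * Jacobi b n"
proof -
  have "Legendre (a * b) p = Legendre a p * Legendre b p" if "p \<in># prime_factorization n" for p
    using that assms
    by (intro Legendre_mult) (auto simp: in_prime_factors_imp_prime dest: dvd_trans[OF _ in_prime_factors_imp_dvd])
  then have "Jacobi (a * b) n = (\<Prod>p\<in>#prime_factorization n. Legendre a p * Legendre b p)"
    unfolding Jacobi_def by (metis (no_types, lifting) image_mset_cong)
  then show ?thesis by (simp add: Jacobi_def prod_mset.distrib)
qed

text \<open>The symbol of a square is the square of an integer. This is the obstruction behind all
  Jacobi symbol arguments below.\<close>

lemma Jacobi_square_nonneg:
  assumes "odd n" "[x\<^sup>2 = a] (mod n)"
  shows "Jacobi a n \<noteq> -1"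
proof -
  have "Jacobi a n = Jacobi x n * Jacobi x n"
    using Jacobi_cong[OF assms(2)] Jacobi_mult_left[OF assms(1), of x x]
    by (simp add: power2_eq_square)
  then show ?thesis
    by (metis not_one_le_zero zero_le_square neg_0_le_iff_le)
qed

text \<open>Splitting off one odd prime at a time lifts laws of the Legendre symbol to the Jacobi
  symbol.\<close>

lemma odd_pos_induct [consumes 2, case_names one mult]:
  fixes n :: int
  assumes "n > 0" "odd n"
    and "P 1"
    and "\<And>p x. prime p \<Longrightarrow> odd p \<Longrightarrow> x > 0 \<Longrightarrow> odd x \<Longrightarrow> P x \<Longrightarrow> P (p * x)"
  shows "P n"
proof -
  have "n > 0 \<longrightarrow> odd n \<longrightarrow> P n"
  proof (induction n rule: prime_divisors_induct)
    case (unit x)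
    then show ?case using assms(3) by auto
  next
    case (factor p x)
    then show ?case
      using assms(4)[of p x] prime_gt_0_int[of p] by (auto simp: zero_less_mult_iff)
  qed simp
  then show ?thesis using assms by blast
qed

lemma Jacobi_one_left [simp]: "n > 0 \<Longrightarrow> odd n \<Longrightarrow> Jacobi 1 n = 1"
proof (induction n rule: odd_pos_induct)
  case (mult p x)
  have "Legendre 1 p = 1"
    using mult(1) prime_ge_2_int[of p] unfolding Legendre_def QuadRes_def
    by (auto simp: cong_0_iff intro!: exI[of _ 1])
  then show ?case using mult by (simp add: Jacobi_mult_right Jacobi_prime)
qed auto

lemma odd_mod4_cases: "odd (n::int) \<Longrightarrow> n mod 4 = 1 \<or> n mod 4 = 3"
  by presburger

lemma odd_mult_mod4:
  assumes "odd (m::int)" "odd n"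
  shows "(m * n) mod 4 = 3 \<longleftrightarrow> (m mod 4 = 3) \<noteq> (n mod 4 = 3)"
proof -
  have "(m * n) mod 4 = ((m mod 4) * (n mod 4)) mod 4" by (simp add: mod_mult_eq)
  then show ?thesis using odd_mod4_cases[OF assms(1)] odd_mod4_cases[OF assms(2)] by auto
qed

lemma Jacobi_minus_one:
  assumes "n > 0" "odd n"
  shows "Jacobi (-1) n = (if n mod 4 = 3 then -1 else 1)"
  using assms
proof (induction n rule: odd_pos_induct)
  case (mult p x)
  then have "Jacobi (-1) (p * x) = Legendre (-1) p * Jacobi (-1) x"
    by (simp add: Jacobi_mult_right Jacobi_prime)
  then show ?case
    using mult Legendre_minus_one[of p] by (simp add: odd_mult_mod4)
qed auto

text \<open>With the sign moved to the right-hand side the law also covers p = q, where both symbols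
  vanish.\<close>

lemma Legendre_reciprocity:
  fixes p q :: int
  assumes "prime p" "odd p" "prime q" "odd q"
  shows "Legendre p q = (if p mod 4 = 3 \<and> q mod 4 = 3 then -1 else 1) * Legendre q p"
proof (cases "p = q")
  case True
  then show ?thesis by (simp add: Legendre_def cong_0_iff)
next
  case False
  have gt: "2 < p" "2 < q" using assms prime_ge_2_int[of p] prime_ge_2_int[of q]
    by (cases "p = 2"; cases "q = 2"; auto)+
  have qr: "Legendre p q * Legendre q p = (-1::int) ^ (nat ((p - 1) div 2 * ((q - 1) div 2)))"
    using Quadratic_Reciprocity_int[of p q] assms gt False by simp
  have "even (nat ((p - 1) div 2 * ((q - 1) div 2))) \<longleftrightarrow> \<not> (p mod 4 = 3 \<and> q mod 4 = 3)"
  proof -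
    have "even (nat ((p - 1) div 2 * ((q - 1) div 2))) \<longleftrightarrow> even ((p - 1) div 2 * ((q - 1) div 2))"
      using gt by (simp add: even_nat_iff)
    moreover have "even ((p - 1) div 2) \<longleftrightarrow> p mod 4 \<noteq> 3" "even ((q - 1) div 2) \<longleftrightarrow> q mod 4 \<noteq> 3"
      using assms by presburger+
    ultimately show ?thesis by auto
  qed
  then have "Legendre p q * Legendre q p = (if p mod 4 = 3 \<and> q mod 4 = 3 then -1 else 1)"
    using qr by (auto simp: minus_one_power_iff)
  then show ?thesis
    using Legendre_values[of p q] Legendre_values[of q p] by (auto split: if_splits)
qed

text \<open>Reciprocity is lifted in one argument at a time, first in n. The sign is multiplicative
  because, among odd numbers, being 3 modulo 4 behaves like a parity
  (\<open>odd_mult_mod4\<close>).\<close>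

lemma Jacobi_reciprocity_prime:
  fixes p n :: int
  assumes "n > 0" "odd n" "prime p" "odd p"
  shows "Jacobi p n = (if p mod 4 = 3 \<and> n mod 4 = 3 then -1 else 1) * Jacobi n p"
  using assms
proof (induction n rule: odd_pos_induct)
  case one
  then show ?case by (simp add: Jacobi_one_left prime_gt_0_int)
next
  case (mult q x)
  have "Jacobi p (q * x) = Legendre p q * Jacobi p x"
    using mult by (simp add: Jacobi_mult_right Jacobi_prime)
  moreover have "Jacobi (q * x) p = Legendre q p * Jacobi x p"
    using mult by (simp add: Legendre_mult Jacobi_prime)
  ultimately show ?case
    using mult Legendre_reciprocity[of p q] by (simp add: odd_mult_mod4)
qed

lemma Jacobi_reciprocity:
  fixes m n :: int
  assumes "m > 0" "odd m" "n > 0" "odd n"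
  shows "Jacobi m n = (if m mod 4 = 3 \<and> n mod 4 = 3 then -1 else 1) * Jacobi n m"
  using assms
proof (induction m rule: odd_pos_induct)
  case one
  then show ?case by (simp add: Jacobi_one_left)
next
  case (mult q x)
  have "Jacobi n (q * x) = Jacobi n q * Jacobi n x"
    using mult by (simp add: Jacobi_mult_right)
  moreover have "Jacobi (q * x) n = Jacobi q n * Jacobi x n"
    using mult by (simp add: Jacobi_mult_left)
  ultimately show ?case
    using mult Jacobi_reciprocity_prime[of n q] by (simp add: odd_mult_mod4)
qed

text \<open>From \<open>2 \<equiv> - (n - 2)\<close> modulo \<open>n\<close> and reciprocity, \<open>(2|n) = (-1|n) (2|n-2)\<close>.\<close>
lemma Jacobi_two:
  assumes "n > 0" "odd n"
  shows "Jacobi 2 n = (if n mod 8 = 1 \<or> n mod 8 = 7 then 1 else -1)"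
proof -
  have "Jacobi 2 (2 * int k + 1) = (if (2 * int k + 1) mod 8 \<in> {1, 7} then 1 else -1)" for k
  proof (induction k)
    case (Suc k)
    define n where "n = 2 * int k + 1"
    have n: "n > 0" "odd n" "n + 2 > 0" "odd (n + 2)" by (auto simp: n_def)
    have "Jacobi 2 (n + 2) = Jacobi (-1 * n) (n + 2)"
      by (rule Jacobi_cong) (simp add: cong_iff_dvd_diff add.commute)
    also have "\<dots> = Jacobi (-1) (n + 2) * Jacobi n (n + 2)"
      using n by (intro Jacobi_mult_left)
    also have "Jacobi n (n + 2) = Jacobi (n + 2) n"
    proof -
      \<comment> \<open>Consecutive odd numbers are never both 3 modulo 4, so reciprocity carries no
        sign.\<close>
      have "\<not> (n mod 4 = 3 \<and> (n + 2) mod 4 = 3)" by presburger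
      then show ?thesis using Jacobi_reciprocity[of n "n + 2"] n by auto
    qed
    also have "Jacobi (n + 2) n = Jacobi 2 n"
      by (rule Jacobi_cong) (simp add: cong_iff_dvd_diff add.commute)
    finally have *: "Jacobi 2 (n + 2) = Jacobi (-1) (n + 2) * Jacobi 2 n" .
    have IH: "Jacobi 2 n = (if n mod 8 \<in> {1, 7} then 1 else -1)"
      using Suc by (simp add: n_def)
    have eq: "2 * int (Suc k) + 1 = n + 2" by (simp add: n_def)
    have m: "Jacobi (-1) (n + 2) = (if (n + 2) mod 4 = 3 then -1 else 1)"
      using Jacobi_minus_one[OF n(3,4)] .
    have "n mod 8 = 1 \<or> n mod 8 = 3 \<or> n mod 8 = 5 \<or> n mod 8 = 7" using n(2) by presburger
    then show ?case
    proof (elim disjE)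
      assume r: "n mod 8 = 1"
      then have "(n + 2) mod 8 = 3" "(n + 2) mod 4 = 3" by presburger+
      then show ?thesis unfolding eq using * IH r m by simp
    next
      assume r: "n mod 8 = 3"
      then have "(n + 2) mod 8 = 5" "(n + 2) mod 4 = 1" by presburger+
      then show ?thesis unfolding eq using * IH r m by simp
    next
      assume r: "n mod 8 = 5"
      then have "(n + 2) mod 8 = 7" "(n + 2) mod 4 = 3" by presburger+
      then show ?thesis unfolding eq using * IH r m by simp
    next
      assume r: "n mod 8 = 7"
      then have "(n + 2) mod 8 = 1" "(n + 2) mod 4 = 1" by presburger+
      then show ?thesis unfolding eq using * IH r m by simp
    qed
  qed (simp add: Jacobi_one_right[of 2, simplified])
  from this[of "nat ((n - 1) div 2)"] show ?thesis
  proof -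
    have "2 * int (nat ((n - 1) div 2)) + 1 = n" using assms by auto
    then show ?thesis using \<open>Jacobi 2 (2 * int (nat ((n - 1) div 2)) + 1) = _\<close> by auto
  qed
qed

section \<open>Lucas and Lehmer sequences\<close>

text \<open>With x and y = 1 / x the roots of X^2 - P X + 1, these are (x^n - y^n) / (x - y) and,
  below, x^n + y^n; the second Lucas parameter is fixed to 1.\<close>

fun lucas_U :: "int \<Rightarrow> nat \<Rightarrow> int" where
  "lucas_U P 0 = 0"
| "lucas_U P (Suc 0) = 1"
| "lucas_U P (Suc (Suc n)) = P * lucas_U P (Suc n) - lucas_U P n"

fun lucas_V :: "int \<Rightarrow> nat \<Rightarrow> int" where
  "lucas_V P 0 = 2"
| "lucas_V P (Suc 0) = P"
| "lucas_V P (Suc (Suc n)) = P * lucas_V P (Suc n) - lucas_V P n"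

text \<open>If \<open>t\<^sup>2 + t\<^sup>-\<^sup>2 = P\<close>, then \<open>lehmer P i\<close> is the Lehmer number
  \<open>(t\<^sup>k - t\<^sup>-\<^sup>k) / (t - t\<^sup>-\<^sup>1)\<close> with \<open>k = 2 i + 1\<close>.\<close>
fun lehmer :: "int \<Rightarrow> nat \<Rightarrow> int" where
  "lehmer P 0 = 1"
| "lehmer P (Suc 0) = P + 1"
| "lehmer P (Suc (Suc n)) = P * lehmer P (Suc n) - lehmer P n"

section \<open>Closed forms and addition formulas\<close>

text \<open>Real roots different from 1 and from each other: integer identities are checked on
  closed forms, and the factors x - 1 or x - y are then cancelled.\<close>

lemma lucas_roots:
  assumes "P \<ge> 3"
  obtains x y :: real where "x > 1" "0 < y" "y < 1" "x + y = of_int P" "x * y = 1"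
proof -
  define p where "p = real_of_int P"
  define s where "s = sqrt (p\<^sup>2 - 4)"
  have p: "p \<ge> 3" using assms by (simp add: p_def)
  have "p\<^sup>2 \<ge> 3\<^sup>2" using p by (intro power_mono) auto
  then have s2: "s\<^sup>2 = p\<^sup>2 - 4" "s > 0" by (auto simp: s_def)
  define x where "x = (p + s) / 2"
  define y where "y = (p - s) / 2"
  have xy: "x + y = p" "x * y = 1" using s2 by (auto simp: x_def y_def field_simps power2_eq_square)
  have x1: "x > 1" using p s2 by (simp add: x_def)
  then have "y = 1 / x" using xy by (simp add: field_simps)
  then have "0 < y" "y < 1" using x1 by auto
  then show ?thesis using that xy x1 by (simp add: p_def)
qed

context
  fixes P :: int and x y :: real
  assumes xy: "x + y = of_int P" "x * y = 1"
begin

lemma lucas_U_closed: "(x - y) * of_int (lucas_U P n) = x ^ n - y ^ n"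
\<comment> \<open>The induction predicate ignores the parameter Q of the recursion, since P is fixed
  by the context.\<close>
proof (induction n rule: lucas_U.induct[of "\<lambda>Q n. (x - y) * of_int (lucas_U P n) = x ^ n - y ^ n"])
  case (3 Q n)
  have "(x - y) * of_int (lucas_U P (Suc (Suc n)))
      = (x + y) * ((x - y) * of_int (lucas_U P (Suc n))) - (x - y) * of_int (lucas_U P n)"
    by (simp add: xy algebra_simps)
  also have "\<dots> = (x + y) * (x ^ Suc n - y ^ Suc n) - (x * y) * (x ^ n - y ^ n)"
    by (simp add: 3 xy)
  finally show ?case by (simp add: algebra_simps)
qed auto

lemma lucas_V_closed: "of_int (lucas_V P n) = x ^ n + y ^ n"
proof (induction n rule: lucas_V.induct[of "\<lambda>Q n. of_int (lucas_V P n) = x ^ n + y ^ n"])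
  case (3 Q n)
  have "of_int (lucas_V P (Suc (Suc n)))
      = (x + y) * (x ^ Suc n + y ^ Suc n) - (x * y) * (x ^ n + y ^ n)"
    by (simp add: 3 xy)
  then show ?case by (simp add: algebra_simps)
qed (auto simp: xy)

text \<open>The fraction (t^k - t^-k) / (t - t^-1) is extended by t; with x = t^2 and k = 2 n + 1 no
  square root of x remains.\<close>

lemma lehmer_closed: "(x - 1) * of_int (lehmer P n) = x ^ Suc n - y ^ n"
proof (induction n rule: lehmer.induct[of "\<lambda>Q n. (x - 1) * of_int (lehmer P n) = x ^ Suc n - y ^ n"])
  case (2 Q)
  show ?case using xy by (simp add: algebra_simps) (simp add: xy(1)[symmetric] algebra_simps)
next
  case (3 Q n)
  have "(x - 1) * of_int (lehmer P (Suc (Suc n)))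
      = (x + y) * ((x - 1) * of_int (lehmer P (Suc n))) - (x - 1) * of_int (lehmer P n)"
    by (simp add: xy algebra_simps)
  also have "\<dots> = (x + y) * (x ^ Suc (Suc n) - y ^ Suc n) - (x * y) * (x ^ Suc n - y ^ n)"
    by (simp add: 3 xy)
  finally show ?case by (simp add: algebra_simps)
qed auto

end

text \<open>The sum-to-product formula for sinh. Modulo \<open>lucas_V P n\<close> it turns a shift
  of the index by 2 n into a change of sign.\<close>

lemma lehmer_add_twice:
  assumes "P \<ge> 3"
  shows "lehmer P (m + 2 * n) + lehmer P m = lucas_V P n * lehmer P (m + n)"
proof -
  obtain x y :: real where xy: "x > 1" "x + y = of_int P" "x * y = 1"
    using lucas_roots[OF assms] by metis
  note L = lehmer_closed[OF xy(2,3)] and V = lucas_V_closed[OF xy(2,3)]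
  define a b where "a = x ^ n" and "b = y ^ n"
  have ab: "a * b = 1" using xy(3) by (simp add: a_def b_def flip: power_mult_distrib)
  have "(x - 1) * of_int (lehmer P (m + 2 * n) + lehmer P m)
      = (x ^ Suc (m + 2 * n) - y ^ (m + 2 * n)) + (x ^ Suc m - y ^ m)"
    using L[of "m + 2 * n"] L[of m] by (simp add: distrib_left)
  also have "\<dots> = a\<^sup>2 * x ^ Suc m - b\<^sup>2 * y ^ m + (x ^ Suc m - y ^ m)"
    by (simp add: a_def b_def power_add power_mult power2_eq_square mult.commute mult.left_commute
        flip: power_mult_distrib)
  \<comment> \<open>Inserting a b = 1 into the last terms makes the sum factor.\<close>
  also have "\<dots> = a\<^sup>2 * x ^ Suc m - b\<^sup>2 * y ^ m + (a * b * x ^ Suc m - a * b * y ^ m)"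
    by (simp add: ab)
  also have "\<dots> = (a + b) * (a * x ^ Suc m - b * y ^ m)"
    by (simp only: power2_eq_square algebra_simps)
  also have "a + b = of_int (lucas_V P n)" by (simp add: V a_def b_def)
  also have "a * x ^ Suc m - b * y ^ m = (x - 1) * of_int (lehmer P (m + n))"
    using L[of "m + n"] by (simp add: a_def b_def power_add mult.commute mult.left_commute)
  finally have "(x - 1) * of_int (lehmer P (m + 2 * n) + lehmer P m)
      = (x - 1) * of_int (lucas_V P n * lehmer P (m + n))"
    by (simp add: mult.left_commute)
  then show ?thesis
    using xy(1) by (metis (no_types, lifting) mult_cancel_left of_int_eq_iff right_minus_eq less_irrefl)
qed

text \<open>The companion difference formula for sinh. It gives a reduction step modulo
  \<open>lehmer P n\<close> for the coprimality proof.\<close>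

lemma lehmer_diff_odd:
  assumes "P \<ge> 3"
  shows "lehmer P (m + 2 * n + 1) - lehmer P m = lucas_V P (m + n + 1) * lehmer P n"
proof -
  obtain x y :: real where xy: "x > 1" "x + y = of_int P" "x * y = 1"
    using lucas_roots[OF assms] by metis
  note L = lehmer_closed[OF xy(2,3)] and V = lucas_V_closed[OF xy(2,3)]
  define a b c d where "a = x ^ n" and "b = y ^ n" and "c = x ^ m" and "d = y ^ m"
  have ab: "a * b = 1" using xy(3) by (simp add: a_def b_def flip: power_mult_distrib)
  have "(x - 1) * of_int (lehmer P (m + 2 * n + 1) - lehmer P m)
      = (x ^ Suc (m + 2 * n + 1) - y ^ (m + 2 * n + 1)) - (x ^ Suc m - y ^ m)"
    using L[of "m + 2 * n + 1"] L[of m] by (simp add: right_diff_distrib)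
  also have "\<dots> = a\<^sup>2 * c * x\<^sup>2 - b\<^sup>2 * d * y - (c * x - d)"
    by (simp add: a_def b_def c_def d_def power_add power_mult power2_eq_square mult.commute
        mult.left_commute flip: power_mult_distrib)
  also have "\<dots> = a\<^sup>2 * c * x\<^sup>2 - b\<^sup>2 * d * y - ((a * b) * c * x - (a * b) * d * (x * y))"
    by (simp add: ab xy(3))
  also have "\<dots> = (a * c * x + b * d * y) * (a * x - b)"
    by (simp only: power2_eq_square algebra_simps)
  also have "a * c * x + b * d * y = of_int (lucas_V P (m + n + 1))"
    by (simp add: V a_def b_def c_def d_def power_add mult.commute mult.left_commute)
  also have "a * x - b = (x - 1) * of_int (lehmer P n)"
    using L[of n] by (simp add: a_def b_def mult.commute)
  finally have "(x - 1) * of_int (lehmer P (m + 2 * n + 1) - lehmer P m)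
      = (x - 1) * of_int (lucas_V P (m + n + 1) * lehmer P n)"
    by (simp add: mult.left_commute)
  then show ?thesis
    using xy(1) by (metis (no_types, lifting) mult_cancel_left of_int_eq_iff right_minus_eq less_irrefl)
qed

text \<open>As (2 i + 1) (2 j + 1) = 2 (2 i j + i + j) + 1, this is W_kl(t) = W_k(t) W_l(t^k) with k
  = 2 i + 1 and l = 2 j + 1; replacing t by t^k replaces P by \<open>lucas_V P k\<close>.\<close>

lemma lehmer_compose:
  assumes "P \<ge> 3"
  shows "lehmer P (2 * i * j + i + j) = lehmer P i * lehmer (lucas_V P (2 * i + 1)) j"
proof -
  obtain x y :: real where xy: "x > 1" "x + y = of_int P" "x * y = 1"
    using lucas_roots[OF assms] by metis
  note L = lehmer_closed[OF xy(2,3)]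
  define X Y where "X = x ^ (2 * i + 1)" and "Y = y ^ (2 * i + 1)"
  have XY: "X + Y = of_int (lucas_V P (2 * i + 1))" "X * Y = 1"
    using lucas_V_closed[OF xy(2,3), of "2 * i + 1"]
    by (simp_all only: X_def Y_def xy(3) power_one flip: power_mult_distrib)
  note L' = lehmer_closed[OF XY]
  have xyi: "x ^ i * y ^ i = 1" using xy(3) by (simp flip: power_mult_distrib)
  have "(x - 1) * of_int (lehmer P i) = y ^ i * (X - 1)"
    using L[of i] xyi by (simp add: X_def power_add power_mult power2_eq_square algebra_simps)
  then have "(x - 1) * of_int (lehmer P i * lehmer (lucas_V P (2 * i + 1)) j)
      = y ^ i * ((X - 1) * of_int (lehmer (lucas_V P (2 * i + 1)) j))"
    by (simp add: mult.assoc[symmetric])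
  also have "\<dots> = y ^ i * (X ^ Suc j - Y ^ j)" by (simp only: L')
  also have "\<dots> = x ^ Suc (2 * i * j + i + j) - y ^ (2 * i * j + i + j)"
  proof -
    have "X ^ Suc j = x ^ i * x ^ Suc (2 * i * j + i + j)"
      by (simp add: X_def flip: power_mult power_add power_Suc) (simp add: algebra_simps)
    moreover have "y ^ i * Y ^ j = y ^ (2 * i * j + i + j)"
      by (simp add: Y_def flip: power_mult power_add power_Suc) (simp add: algebra_simps)
    ultimately show ?thesis using xyi by (simp add: right_diff_distrib) (simp add: mult.assoc[symmetric] mult.commute)
  qed
  also have "\<dots> = (x - 1) * of_int (lehmer P (2 * i * j + i + j))" by (simp only: L)
  finally show ?thesis
    using xy(1) by (metis (no_types, lifting) mult_cancel_left of_int_eq_iff right_minus_eq less_irrefl)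
qed

lemma lucas_V_add_twice:
  assumes "P \<ge> 3"
  shows "lucas_V P (m + 2 * n) + lucas_V P m = lucas_V P n * lucas_V P (m + n)"
proof -
  obtain x y :: real where xy: "x > 1" "x + y = of_int P" "x * y = 1"
    using lucas_roots[OF assms] by metis
  note V = lucas_V_closed[OF xy(2,3)]
  define a b where "a = x ^ n" and "b = y ^ n"
  have ab: "a * b = 1" using xy(3) by (simp add: a_def b_def flip: power_mult_distrib)
  have "of_int (lucas_V P (m + 2 * n) + lucas_V P m) = a\<^sup>2 * x ^ m + b\<^sup>2 * y ^ m + (x ^ m + y ^ m)"
    by (simp add: V a_def b_def power_add power_mult power2_eq_square mult.commute mult.left_commute
        flip: power_mult_distrib)
  also have "\<dots> = a\<^sup>2 * x ^ m + b\<^sup>2 * y ^ m + (a * b * x ^ m + a * b * y ^ m)"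
    by (simp add: ab)
  also have "\<dots> = (a + b) * (a * x ^ m + b * y ^ m)"
    by (simp only: power2_eq_square algebra_simps)
  also have "\<dots> = of_int (lucas_V P n * lucas_V P (m + n))"
    by (simp add: V a_def b_def power_add mult.commute)
  finally show ?thesis by linarith
qed

lemma lucas_V_double:
  assumes "P \<ge> 3"
  shows "lucas_V P (2 * n) = (lucas_V P n)\<^sup>2 - 2"
  using lucas_V_add_twice[OF assms, of 0 n] by (simp add: power2_eq_square)

lemma lucas_U_double:
  assumes "P \<ge> 3"
  shows "lucas_U P (2 * n) = lucas_U P n * lucas_V P n"
proof -
  obtain x y :: real where xy: "x > 1" "y < 1" "x + y = of_int P" "x * y = 1"
    using lucas_roots[OF assms] by metis
  have "(x - y) * of_int (lucas_U P (2 * n)) = (x ^ n - y ^ n) * (x ^ n + y ^ n)"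
    using lucas_U_closed[OF xy(3,4), of "2 * n"] by (simp add: power_mult power2_eq_square
        algebra_simps power_mult_distrib)
  also have "\<dots> = (x - y) * of_int (lucas_U P n * lucas_V P n)"
    using lucas_U_closed[OF xy(3,4), of n] lucas_V_closed[OF xy(3,4), of n] by simp
  finally show ?thesis using xy(1,2) by (simp del: of_int_mult)
qed

text \<open>The addition theorem for \<open>sinh\<close>.\<close>
lemma lehmer_via_lucas:
  assumes "P \<ge> 3"
  shows "2 * lehmer P (n + 1) = lucas_U P n * (P + 2) * (P - 1) + lucas_V P n * (P + 1)"
proof -
  obtain x y :: real where xy: "x > 1" "y < 1" "x + y = of_int P" "x * y = 1"
    using lucas_roots[OF assms] by metis
  define a b where "a = x ^ n" and "b = y ^ n"
  have L: "(x - 1) * of_int (lehmer P (n + 1)) = a * x\<^sup>2 - b * y"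
    using lehmer_closed[OF xy(3,4), of "n + 1"]
    by (simp add: a_def b_def power2_eq_square mult.commute mult.left_commute)
  have U: "(x - y) * of_int (lucas_U P n) = a - b" and V: "of_int (lucas_V P n) = a + b"
    using lucas_U_closed[OF xy(3,4), of n] lucas_V_closed[OF xy(3,4), of n]
    by (simp_all add: a_def b_def)
  have "(x - 1) * (x - y) * of_int (2 * lehmer P (n + 1)) = 2 * (x - y) * (a * x\<^sup>2 - b * y)"
    by (simp flip: L)
  also have "\<dots> = (x - 1) * ((a - b) * ((x + y + 2) * (x + y - 1)) + (x - y) * (a + b) * (x + y + 1))"
  proof -
    have 1: "(x + y + 2) * (x + y - 1) = x\<^sup>2 + y\<^sup>2 + x + y"
      using xy(4) by (simp add: power2_eq_square algebra_simps)
    have 2: "(x - 1) * (y + 1) = x - y"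
      using xy(4) by (simp add: algebra_simps)
    have 3: "(a - b) * (x\<^sup>2 + y\<^sup>2 + x + y) + (x - y) * (a + b) * (x + y + 1)
        = 2 * a * x * (x + 1) - 2 * b * y * (y + 1)"
      by (simp add: power2_eq_square algebra_simps)
    have 4: "(x - 1) * (2 * a * x * (x + 1)) = 2 * (x - y) * (a * x\<^sup>2)"
    proof -
      have "x * ((x - 1) * (x + 1)) = x\<^sup>2 * (x - y)"
        using xy(4) by (simp add: power2_eq_square algebra_simps)
      have "(x - 1) * (2 * a * x * (x + 1)) = 2 * a * (x * ((x - 1) * (x + 1)))"
        by (simp add: algebra_simps)
      also have "\<dots> = 2 * a * (x\<^sup>2 * (x - y))" by (simp only: \<open>x * ((x - 1) * (x + 1)) = x\<^sup>2 * (x - y)\<close>)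
      finally show ?thesis by (simp add: algebra_simps)
    qed
    have 5: "(x - 1) * (2 * b * y * (y + 1)) = 2 * (x - y) * (b * y)"
      by (simp flip: 2 add: mult.commute mult.left_commute)
    show ?thesis unfolding 1 3 using 4 5 by (simp only: right_diff_distrib)
  qed
  also have "\<dots> = (x - 1) * (((x - y) * of_int (lucas_U P n)) * ((x + y + 2) * (x + y - 1))
      + (x - y) * (a + b) * (x + y + 1))"
    by (simp only: U)
  also have "\<dots> = (x - 1) * (x - y)
      * of_int (lucas_U P n * (P + 2) * (P - 1) + lucas_V P n * (P + 1))"
    by (simp add: V algebra_simps flip: xy(3))
  finally have "(x - 1) * (x - y) * of_int (2 * lehmer P (n + 1)) = (x - 1) * (x - y)
      * of_int (lucas_U P n * (P + 2) * (P - 1) + lucas_V P n * (P + 1))" .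
  then show ?thesis using xy(1,2)
    by (metis (no_types, lifting) mult_cancel_left of_int_eq_iff right_minus_eq less_irrefl mult_eq_0_iff order.strict_trans)
qed

section \<open>Growth of the sequences and their residues modulo \<open>lucas_V P n\<close>\<close>

lemma lucas_V_mono: "P \<ge> 3 \<Longrightarrow> 2 \<le> lucas_V P n \<and> lucas_V P n < lucas_V P (Suc n)"
proof (induction n)
  case (Suc n)
  have "lucas_V P (Suc (Suc n)) = P * lucas_V P (Suc n) - lucas_V P n" by simp
  moreover have "3 * lucas_V P (Suc n) \<le> P * lucas_V P (Suc n)"
    using Suc by (intro mult_right_mono) auto
  ultimately show ?case using Suc by linarith
qed simp

lemma lucas_V_ge:
  assumes "P \<ge> 3" "n \<ge> 1"
  shows "lucas_V P n \<ge> 3"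
proof -
  obtain m where "n = Suc m" using assms(2) by (cases n) auto
  moreover have "lucas_V P (Suc m) \<ge> 3" using lucas_V_mono[OF assms(1), of m] by linarith
  ultimately show ?thesis by simp
qed

lemma lehmer_pos: "P \<ge> 3 \<Longrightarrow> 0 < lehmer P n \<and> lehmer P n < lehmer P (Suc n)"
proof (induction n)
  case (Suc n)
  have "lehmer P (Suc (Suc n)) = P * lehmer P (Suc n) - lehmer P n" by simp
  moreover have "3 * lehmer P (Suc n) \<le> P * lehmer P (Suc n)"
    using Suc by (intro mult_right_mono) auto
  ultimately show ?case using Suc by linarith
qed simp

lemma lehmer_cong_step:
  assumes "P \<ge> 3"
  shows "[lehmer P (m + 2 * n * g) = (-1) ^ g * lehmer P m] (mod lucas_V P n)"
proof (induction g)
  case (Suc g)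
  have "lehmer P (m + 2 * n * Suc g) = - lehmer P (m + 2 * n * g)
      + lucas_V P n * lehmer P (m + 2 * n * g + n)"
    using lehmer_add_twice[OF assms, of "m + 2 * n * g" n] by (simp add: algebra_simps)
  then have "[lehmer P (m + 2 * n * Suc g) = - lehmer P (m + 2 * n * g)] (mod lucas_V P n)"
    by (simp add: cong_iff_dvd_diff)
  moreover have "[- lehmer P (m + 2 * n * g) = - ((-1) ^ g * lehmer P m)] (mod lucas_V P n)"
    using Suc by (simp add: cong_minus_minus_iff)
  ultimately show ?case by (metis cong_trans minus_mult_left mult_minus1 power_Suc mult.assoc)
qed simp

lemma lucas_V_cong_step:
  assumes "P \<ge> 3"
  shows "[lucas_V P (m + 2 * n * g) = (-1) ^ g * lucas_V P m] (mod lucas_V P n)"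
proof (induction g)
  case (Suc g)
  have "lucas_V P (m + 2 * n * Suc g) = - lucas_V P (m + 2 * n * g)
      + lucas_V P n * lucas_V P (m + 2 * n * g + n)"
    using lucas_V_add_twice[OF assms, of "m + 2 * n * g" n] by (simp add: algebra_simps)
  then have "[lucas_V P (m + 2 * n * Suc g) = - lucas_V P (m + 2 * n * g)] (mod lucas_V P n)"
    by (simp add: cong_iff_dvd_diff)
  moreover have "[- lucas_V P (m + 2 * n * g) = - ((-1) ^ g * lucas_V P m)] (mod lucas_V P n)"
    using Suc by (simp add: cong_minus_minus_iff)
  ultimately show ?case by (metis cong_trans minus_mult_left mult_minus1 power_Suc mult.assoc)
qed simp

lemma even_decompose:
  fixes n :: nat
  assumes "n > 0"
  obtains r g where "n = 2 ^ r * g" "odd g"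
proof -
  have "\<exists>r g. n = 2 ^ r * g \<and> odd g" using assms
  proof (induction n rule: less_induct)
    case (less n)
    show ?case
    proof (cases "odd n")
      case True
      then show ?thesis by (intro exI[of _ 0] exI[of _ n]) auto
    next
      case False
      then obtain m where m: "n = 2 * m" by auto
      then obtain r g where "m = 2 ^ r * g" "odd g" using less.IH[of m] less.prems by auto
      then show ?thesis using m by (intro exI[of _ "Suc r"] exI[of _ g]) auto
    qed
  qed
  then show ?thesis using that by blast
qed

section \<open>Pade approximants to the square root\<close>

lemma odd_lehmer: "even P \<Longrightarrow> odd (lehmer P n)"
  by (induction P n rule: lehmer.induct) auto

section \<open>Arithmetic in the ring Z[w], where w = t^2\<close>

locale quadratic_unit =
  fixes P :: int and w v :: real
  assumes P: "P \<ge> 4" "even P" and wv: "w + v = of_int P" "w * v = 1" and w1: "w > 1"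
begin

text \<open>An element of Z[w] is represented by the pair of its two real embeddings, so conjugation
  is a swap and norm and trace are plain product and sum.\<close>

definition conj_pair :: "real \<Rightarrow> real \<Rightarrow> bool" where
  "conj_pair x y \<longleftrightarrow> (\<exists>a b :: int. x = of_int a + of_int b * w \<and> y = of_int a + of_int b * v)"

lemma conj_pair_of_int [intro]: "conj_pair (of_int a) (of_int a)"
  unfolding conj_pair_def by (rule exI[of _ a], rule exI[of _ 0]) simp

lemma conj_pair_numeral [intro]: "conj_pair 1 1" "conj_pair 0 0" "conj_pair (numeral n) (numeral n)"
  using conj_pair_of_int[of 1] conj_pair_of_int[of 0] conj_pair_of_int[of "numeral n"] by simp_all

lemma conj_pair_w [intro]: "conj_pair w v"
  unfolding conj_pair_def by (rule exI[of _ 0], rule exI[of _ 1]) simp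

lemma conj_pair_add [intro]: "conj_pair x y \<Longrightarrow> conj_pair x' y' \<Longrightarrow> conj_pair (x + x') (y + y')"
proof -
  assume "conj_pair x y" "conj_pair x' y'"
  then obtain a b a' b' :: int where
    "x = of_int a + of_int b * w" "y = of_int a + of_int b * v"
    "x' = of_int a' + of_int b' * w" "y' = of_int a' + of_int b' * v"
    unfolding conj_pair_def by blast
  then show ?thesis unfolding conj_pair_def
    by (intro exI[of _ "a + a'"] exI[of _ "b + b'"]) (simp add: algebra_simps)
qed

lemma root_squares: "w * w = of_int P * w - 1" "v * v = of_int P * v - 1"
  using wv(2) by (simp_all add: algebra_simps flip: wv(1))

lemma conj_pair_mult [intro]: "conj_pair x y \<Longrightarrow> conj_pair x' y' \<Longrightarrow> conj_pair (x * x') (y * y')"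
proof -
  assume "conj_pair x y" "conj_pair x' y'"
  then obtain a b a' b' :: int where
    *: "x = of_int a + of_int b * w" "y = of_int a + of_int b * v"
    "x' = of_int a' + of_int b' * w" "y' = of_int a' + of_int b' * v"
    unfolding conj_pair_def by blast
  have "x * x' = of_int a * of_int a' + (of_int a * of_int b' + of_int b * of_int a') * w
      + of_int b * of_int b' * (w * w)"
    "y * y' = of_int a * of_int a' + (of_int a * of_int b' + of_int b * of_int a') * v
      + of_int b * of_int b' * (v * v)"
    by (simp_all add: * algebra_simps)
  then show ?thesis unfolding conj_pair_def root_squares
    by (intro exI[of _ "a * a' - b * b'"] exI[of _ "a * b' + b * a' + P * b * b'"])
      (simp add: algebra_simps)
qed

lemma conj_pair_minus [intro]: "conj_pair x y \<Longrightarrow> conj_pair (- x) (- y)"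
  using conj_pair_mult[OF conj_pair_of_int[of "-1"]] by simp

lemma conj_pair_diff [intro]: "conj_pair x y \<Longrightarrow> conj_pair x' y' \<Longrightarrow> conj_pair (x - x') (y - y')"
  using conj_pair_add[OF _ conj_pair_minus] by fastforce

lemma conj_pair_power [intro]: "conj_pair x y \<Longrightarrow> conj_pair (x ^ n) (y ^ n)"
  by (induction n) auto

lemma conj_pair_norm: "conj_pair x y \<Longrightarrow> \<exists>n :: int. x * y = of_int n"
proof -
  assume "conj_pair x y"
  then obtain a b :: int where "x = of_int a + of_int b * w" "y = of_int a + of_int b * v"
    unfolding conj_pair_def by blast
  then have "x * y = of_int a * of_int a + of_int a * of_int b * (w + v) + of_int b * of_int b * (w * v)"
    by (simp add: algebra_simps)
  then show ?thesis by (intro exI[of _ "a * a + a * b * P + b * b"]) (simp add: wv)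
qed

lemma conj_pair_trace: "conj_pair x y \<Longrightarrow> \<exists>n :: int. x + y = of_int n"
proof -
  assume "conj_pair x y"
  then obtain a b :: int where "x = of_int a + of_int b * w" "y = of_int a + of_int b * v"
    unfolding conj_pair_def by blast
  then have "x + y = of_int a + of_int a + of_int b * (w + v)"
    by (simp add: algebra_simps)
  then show ?thesis by (intro exI[of _ "a + a + b * P"]) (simp add: wv)
qed

lemma conj_pair_diff_multiple: "conj_pair x y \<Longrightarrow> \<exists>n :: int. x - y = of_int n * (w - v)"
  unfolding conj_pair_def by (auto simp: algebra_simps)

lemma v_bounds: "0 < v" "v < 1"
  using wv(2) w1 by (smt (verit) mult_less_cancel_left2 mult_nonneg_nonpos zero_less_mult_pos)+

text \<open>Completing the square would make the discriminant P^2 - 4 a perfect square, but it lies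
  strictly between (P - 1)^2 and P^2.\<close>

lemma norm_form_eq_0:
  fixes a b :: int
  assumes "a * a + a * b * P + b * b = 0"
  shows "b = 0"
proof (rule ccontr)
  assume "b \<noteq> 0"
  have eq: "(2 * a + b * P)\<^sup>2 = b\<^sup>2 * (P\<^sup>2 - 4)"
    using assms by (simp add: power2_eq_square algebra_simps)
  then have "b\<^sup>2 dvd (2 * a + b * P)\<^sup>2" by simp
  then have "b dvd 2 * a + b * P" by simp
  then obtain s where s: "2 * a + b * P = b * s" by auto
  have "b\<^sup>2 * s\<^sup>2 = b\<^sup>2 * (P\<^sup>2 - 4)" using eq unfolding s by (simp add: power_mult_distrib)
  then have "\<bar>s\<bar>\<^sup>2 = P\<^sup>2 - 4" using \<open>b \<noteq> 0\<close> by simp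
  moreover have "P\<^sup>2 - 4 < P\<^sup>2" "(P - 1)\<^sup>2 < P\<^sup>2 - 4" using P by (simp_all add: power2_eq_square algebra_simps)
  ultimately have "\<bar>s\<bar>\<^sup>2 < P\<^sup>2" "(P - 1)\<^sup>2 < \<bar>s\<bar>\<^sup>2" by simp_all
  then have "\<bar>s\<bar> < P" "P - 1 < \<bar>s\<bar>" using P by (auto intro: power2_less_imp_less)
  then show False by simp
qed

lemma conj_pair_eq_0_iff: "conj_pair x y \<Longrightarrow> x * y = 0 \<Longrightarrow> x = 0 \<and> y = 0"
proof -
  assume "conj_pair x y" and 0: "x * y = 0"
  then obtain a b :: int where *: "x = of_int a + of_int b * w" "y = of_int a + of_int b * v"
    unfolding conj_pair_def by blast
  then have "x * y = of_int a * of_int a + of_int a * of_int b * (w + v) + of_int b * of_int b * (w * v)"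
    by (simp add: algebra_simps)
  then have "of_int (a * a + a * b * P + b * b) = (0 :: real)" using 0 by (simp add: wv)
  then have n0: "a * a + a * b * P + b * b = 0" by linarith
  then have "b = 0" by (rule norm_form_eq_0)
  then show ?thesis using n0 * by simp
qed

text \<open>Because w is irrational, an identity known at w transfers to the conjugate v.\<close>

lemma conj_pair_unique:
  assumes "conj_pair x y" "conj_pair x y'"
  shows "y = y'"
  using conj_pair_eq_0_iff[OF conj_pair_diff[OF assms]] by simp

text \<open>Congruence to 1 modulo 2 in Z[w]: a multiplicatively closed class whose members have odd
  norm.\<close>

definition odd_pair :: "real \<Rightarrow> real \<Rightarrow> bool" where
  "odd_pair x y \<longleftrightarrow> (\<exists>s t. conj_pair s t \<and> x = 1 + 2 * s \<and> y = 1 + 2 * t)"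

lemma odd_pair_mult [intro]: "odd_pair x y \<Longrightarrow> odd_pair x' y' \<Longrightarrow> odd_pair (x * x') (y * y')"
proof -
  assume "odd_pair x y" "odd_pair x' y'"
  then obtain s t s' t' where *: "conj_pair s t" "x = 1 + 2 * s" "y = 1 + 2 * t"
    "conj_pair s' t'" "x' = 1 + 2 * s'" "y' = 1 + 2 * t'" unfolding odd_pair_def by blast
  have "conj_pair (s + s' + 2 * (s * s')) (t + t' + 2 * (t * t'))" using * by blast
  then show ?thesis unfolding odd_pair_def
    by (intro exI[of _ "s + s' + 2 * (s * s')"] exI[of _ "t + t' + 2 * (t * t')"])
      (simp add: * algebra_simps)
qed

lemma odd_pair_add_even [intro]:
  "odd_pair x y \<Longrightarrow> conj_pair s t \<Longrightarrow> odd_pair (x + 2 * s) (y + 2 * t)"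
proof -
  assume "odd_pair x y" "conj_pair s t"
  then obtain s' t' where *: "conj_pair s' t'" "x = 1 + 2 * s'" "y = 1 + 2 * t'"
    unfolding odd_pair_def by blast
  then have "conj_pair (s' + s) (t' + t)" using \<open>conj_pair s t\<close> by blast
  then show ?thesis unfolding odd_pair_def
    by (intro exI[of _ "s' + s"] exI[of _ "t' + t"]) (simp add: * algebra_simps)
qed

lemma odd_pair_one [intro]: "odd_pair 1 1"
  unfolding odd_pair_def by (intro exI[of _ 0]) auto

lemma odd_pair_imp_conj_pair [dest]: "odd_pair x y \<Longrightarrow> conj_pair x y"
  unfolding odd_pair_def by blast

lemma odd_pair_norm: "odd_pair x y \<Longrightarrow> \<exists>n :: int. odd n \<and> x * y = of_int n"
proof -
  assume "odd_pair x y"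
  then obtain s t where *: "conj_pair s t" "x = 1 + 2 * s" "y = 1 + 2 * t"
    unfolding odd_pair_def by blast
  obtain m n :: int where "s + t = of_int m" "s * t = of_int n"
    using conj_pair_trace[OF *(1)] conj_pair_norm[OF *(1)] by blast
  then have "x * y = of_int (1 + 2 * m + 4 * n)"
    using * by (simp add: algebra_simps)
  then show ?thesis by (intro exI[of _ "1 + 2 * m + 4 * n"]) simp
qed

end

text \<open>Powers \<open>(r + \<surd>(r (r - 1)))\<^sup>n = pade_A r n + pade_B r n \<surd>(r (r - 1))\<close>. With \<open>x = 1 - 1 / r\<close>
  they yield the Pade approximants to \<open>\<surd>x\<close>.\<close>
fun pade_A :: "real \<Rightarrow> nat \<Rightarrow> real" and pade_B :: "real \<Rightarrow> nat \<Rightarrow> real" where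
  "pade_A r 0 = 1"
| "pade_A r (Suc n) = r * pade_A r n + r * (r - 1) * pade_B r n"
| "pade_B r 0 = 0"
| "pade_B r (Suc n) = pade_A r n + r * pade_B r n"

text \<open>Norms are multiplicative, and r + sqrt(r (r - 1)) has norm r^2 - r (r - 1) = r.\<close>

lemma pade_norm: "(pade_A r n)\<^sup>2 - r * (r - 1) * (pade_B r n)\<^sup>2 = r ^ n"
proof (induction n)
  case (Suc n)
  have "(pade_A r (Suc n))\<^sup>2 - r * (r - 1) * (pade_B r (Suc n))\<^sup>2
      = r * ((pade_A r n)\<^sup>2 - r * (r - 1) * (pade_B r n)\<^sup>2)"
    by (simp add: power2_eq_square algebra_simps)
  then show ?case by (simp add: Suc)
qed simp

lemma pade_closed:
  assumes "q\<^sup>2 = r * (r - 1)"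
  shows "pade_A r n + pade_B r n * q = (r + q) ^ n"
proof (induction n)
  case (Suc n)
  have "pade_A r (Suc n) + pade_B r (Suc n) * q
      = r * pade_A r n + q\<^sup>2 * pade_B r n + (pade_A r n + r * pade_B r n) * q"
    by (simp add: assms)
  also have "\<dots> = (r + q) * (pade_A r n + pade_B r n * q)"
    by (simp add: power2_eq_square algebra_simps)
  finally show ?case by (simp add: Suc)
qed simp

text \<open>The same for even exponents: \<open>dbl_C r n + 2 dbl_D r n \<surd>(r (r - 1))\<close> is the \<open>n\<close>-th power
  of \<open>(r + \<surd>(r (r - 1)))\<^sup>2 / r\<close>.\<close>
fun dbl_C :: "real \<Rightarrow> nat \<Rightarrow> real" and dbl_D :: "real \<Rightarrow> nat \<Rightarrow> real" where
  "dbl_C r 0 = 1"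
| "dbl_C r (Suc n) = (2 * r - 1) * dbl_C r n + 4 * r * (r - 1) * dbl_D r n"
| "dbl_D r 0 = 0"
| "dbl_D r (Suc n) = dbl_C r n + (2 * r - 1) * dbl_D r n"

text \<open>Together with \<open>odd_B\<close>: the coefficients of the odd power 2 n + 1 freed from
  the factors r^(n+1) and r^n, see \<open>pade_odd\<close>.\<close>

definition odd_A :: "real \<Rightarrow> nat \<Rightarrow> real" where
  "odd_A r n = dbl_C r n + 2 * (r - 1) * dbl_D r n"

definition odd_B :: "real \<Rightarrow> nat \<Rightarrow> real" where
  "odd_B r n = dbl_C r n + 2 * r * dbl_D r n"

lemma pade_even: "pade_A r (2 * n) = r ^ n * dbl_C r n \<and> pade_B r (2 * n) = 2 * r ^ n * dbl_D r n"
proof (induction n)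
  case (Suc n)
  have "pade_A r (2 * Suc n)
      = r * (r * pade_A r (2 * n) + r * (r - 1) * pade_B r (2 * n))
        + r * (r - 1) * (pade_A r (2 * n) + r * pade_B r (2 * n))"
    "pade_B r (2 * Suc n)
      = (r * pade_A r (2 * n) + r * (r - 1) * pade_B r (2 * n))
        + r * (pade_A r (2 * n) + r * pade_B r (2 * n))" by simp_all
  then show ?case
    unfolding Suc[THEN conjunct1] Suc[THEN conjunct2] by (simp add: algebra_simps)
qed simp

lemma pade_odd:
  "pade_A r (2 * n + 1) = r ^ Suc n * odd_A r n" "pade_B r (2 * n + 1) = r ^ n * odd_B r n"
  using pade_even[of r n] by (simp_all add: odd_A_def odd_B_def algebra_simps)

lemma dbl_norm: "(dbl_C r n)\<^sup>2 - 4 * r * (r - 1) * (dbl_D r n)\<^sup>2 = 1"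
proof (induction n)
  case (Suc n)
  have "(dbl_C r (Suc n))\<^sup>2 - 4 * r * (r - 1) * (dbl_D r (Suc n))\<^sup>2
      = (dbl_C r n)\<^sup>2 - 4 * r * (r - 1) * (dbl_D r n)\<^sup>2"
    by (simp add: power2_eq_square algebra_simps)
  then show ?case by (simp add: Suc)
qed simp

lemma dbl_add:
  "dbl_C r (m + n) = dbl_C r m * dbl_C r n + 4 * r * (r - 1) * dbl_D r m * dbl_D r n \<and>
   dbl_D r (m + n) = dbl_C r m * dbl_D r n + dbl_D r m * dbl_C r n"
proof (induction m)
  case (Suc m)
  show ?case
    unfolding add_Suc dbl_C.simps dbl_D.simps Suc[THEN conjunct1] Suc[THEN conjunct2]
    by (simp add: algebra_simps)
qed simp

lemma dbl_double:
  "dbl_C r (2 * n) = 2 * (dbl_C r n)\<^sup>2 - 1" "dbl_D r (2 * n) = 2 * dbl_C r n * dbl_D r n"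
proof -
  have "dbl_C r (n + n) = 2 * (dbl_C r n)\<^sup>2 - 1"
    using dbl_add[of r n n] dbl_norm[of r n] by (simp add: power2_eq_square)
  then show "dbl_C r (2 * n) = 2 * (dbl_C r n)\<^sup>2 - 1" by (simp only: mult_2[of n])
  have "dbl_D r (n + n) = 2 * dbl_C r n * dbl_D r n"
    using dbl_add[of r n n] by simp
  then show "dbl_D r (2 * n) = 2 * dbl_C r n * dbl_D r n" by (simp only: mult_2[of n])
qed

text \<open>Here and in \<open>odd_AB_odd\<close>, half-index formulas expose one common factor
  \<open>dbl_D\<close>. At w the remaining \<open>odd_A\<close> and \<open>odd_B\<close> are odd, so
  the powers of 2 in both differences can be compared.\<close>

lemma odd_AB_even:
  "odd_A r (2 * n) - 1 = 4 * (r - 1) * dbl_D r n * odd_B r n"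
  "odd_B r (2 * n) - 1 = 4 * r * dbl_D r n * odd_A r n"
proof -
  define c d where "c = dbl_C r n" and "d = dbl_D r n"
  have N: "c\<^sup>2 = 1 + 4 * r * (r - 1) * d\<^sup>2" using dbl_norm[of r n] by (simp add: c_def d_def)
  have "odd_A r (2 * n) - 1 = 2 * c\<^sup>2 - 2 + 4 * (r - 1) * c * d"
    "odd_B r (2 * n) - 1 = 2 * c\<^sup>2 - 2 + 4 * r * c * d"
    by (simp_all add: odd_A_def odd_B_def dbl_double c_def d_def)
  then show "odd_A r (2 * n) - 1 = 4 * (r - 1) * dbl_D r n * odd_B r n"
    "odd_B r (2 * n) - 1 = 4 * r * dbl_D r n * odd_A r n"
    unfolding N odd_A_def odd_B_def c_def[symmetric] d_def[symmetric]
    by (simp_all add: power2_eq_square algebra_simps)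
qed

lemma odd_AB_odd:
  "odd_A r (2 * n + 1) - 1 = 4 * (r - 1) * dbl_D r (n + 1) * odd_B r n"
  "odd_B r (2 * n + 1) + 1 = 4 * r * dbl_D r (n + 1) * odd_A r n"
proof -
  define c d where "c = dbl_C r n" and "d = dbl_D r n"
  have N: "c\<^sup>2 = 1 + 4 * r * (r - 1) * d\<^sup>2" using dbl_norm[of r n] by (simp add: c_def d_def)
  have CD: "dbl_C r (2 * n + 1) = (2 * r - 1) * (2 * c\<^sup>2 - 1) + 8 * r * (r - 1) * (c * d)"
    "dbl_D r (2 * n + 1) = 2 * c\<^sup>2 - 1 + 2 * (2 * r - 1) * (c * d)"
    "dbl_D r (n + 1) = c + (2 * r - 1) * d"
    by (simp_all add: dbl_double c_def d_def)
  show "odd_A r (2 * n + 1) - 1 = 4 * (r - 1) * dbl_D r (n + 1) * odd_B r n"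
  proof -
    have h1: "odd_A r (2 * n + 1) - 1
        = 2 * (4 * r - 3) * c\<^sup>2 - (4 * r - 2) + 4 * (r - 1) * (4 * r - 1) * (c * d)"
      unfolding odd_A_def CD by (simp add: algebra_simps)
    have h2: "4 * (r - 1) * dbl_D r (n + 1) * odd_B r n
        = 4 * (r - 1) * c\<^sup>2 + 4 * (r - 1) * (4 * r - 1) * (c * d)
          + (2 * (2 * r - 1)) * (4 * r * (r - 1) * d\<^sup>2)"
      unfolding odd_B_def CD c_def[symmetric] d_def[symmetric]
      by (simp add: power2_eq_square algebra_simps)
    have h3: "4 * r * (r - 1) * d\<^sup>2 = c\<^sup>2 - 1" using N by simp
    show ?thesis unfolding h1 h2 h3 by (simp add: algebra_simps)
  qed
  show "odd_B r (2 * n + 1) + 1 = 4 * r * dbl_D r (n + 1) * odd_A r n"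
  proof -
    have h1: "odd_B r (2 * n + 1) + 1
        = 2 * (4 * r - 1) * c\<^sup>2 - (4 * r - 2) + 4 * r * (4 * r - 3) * (c * d)"
      unfolding odd_B_def CD by (simp add: algebra_simps)
    have h2: "4 * r * dbl_D r (n + 1) * odd_A r n
        = 4 * r * c\<^sup>2 + 4 * r * (4 * r - 3) * (c * d)
          + (2 * (2 * r - 1)) * (4 * r * (r - 1) * d\<^sup>2)"
      unfolding odd_A_def CD c_def[symmetric] d_def[symmetric]
      by (simp add: power2_eq_square algebra_simps)
    have h3: "4 * r * (r - 1) * d\<^sup>2 = c\<^sup>2 - 1" using N by simp
    show ?thesis unfolding h1 h2 h3 by (simp add: algebra_simps)
  qed
qed

lemma dbl_nonneg: "r > 1 \<Longrightarrow> dbl_C r n > 0 \<and> dbl_D r n \<ge> 0"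
  by (induction n) (auto intro!: add_pos_nonneg)

context quadratic_unit
begin

lemmas conj_pair_intros = conj_pair_add conj_pair_diff conj_pair_mult conj_pair_power
  conj_pair_w conj_pair_numeral conj_pair_of_int

lemma conj_pair_pade:
  "conj_pair (pade_A w n) (pade_A v n) \<and> conj_pair (pade_B w n) (pade_B v n)"
proof (induction n)
  case (Suc n)
  then show ?case unfolding pade_A.simps pade_B.simps
    by (elim conjE) (intro conjI conj_pair_intros)
qed (simp add: conj_pair_numeral)

lemma dbl_odd_C:
  "odd_pair (dbl_C w n) (dbl_C v n) \<and> conj_pair (dbl_D w n) (dbl_D v n)"
proof (induction n)
  case (Suc n)
  then have IH: "odd_pair (dbl_C w n) (dbl_C v n)" "conj_pair (dbl_C w n) (dbl_C v n)"
    "conj_pair (dbl_D w n) (dbl_D v n)" by auto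
  have "odd_pair (dbl_C w n + 2 * ((w - 1) * dbl_C w n + 2 * w * (w - 1) * dbl_D w n))
      (dbl_C v n + 2 * ((v - 1) * dbl_C v n + 2 * v * (v - 1) * dbl_D v n))"
    by (intro odd_pair_add_even IH conj_pair_intros)
  moreover have e: "dbl_C r (Suc n) = dbl_C r n + 2 * ((r - 1) * dbl_C r n + 2 * r * (r - 1) * dbl_D r n)"
    for r by (simp add: algebra_simps)
  moreover have "conj_pair (dbl_D w (Suc n)) (dbl_D v (Suc n))"
    unfolding dbl_D.simps by (intro IH conj_pair_intros)
  ultimately show ?case unfolding e by blast
qed (simp add: conj_pair_numeral odd_pair_one)

lemma odd_pair_odd_AB:
  "odd_pair (odd_A w n) (odd_A v n)" "odd_pair (odd_B w n) (odd_B v n)"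
  unfolding odd_A_def odd_B_def mult.assoc
  by (intro odd_pair_add_even conj_pair_intros dbl_odd_C[THEN conjunct1] dbl_odd_C[THEN conjunct2])+

text \<open>Doubling the index contributes 2 and the odd element \<open>dbl_C\<close>; at an odd
  index \<open>dbl_D\<close> is itself odd. The induction thus takes 2^f to be the power of 2 in
  n.\<close>

lemma dbl_D_decompose:
  assumes "n \<ge> 1"
  shows "\<exists>f x y. odd_pair x y \<and> dbl_D w n = 2 ^ f * x \<and> dbl_D v n = 2 ^ f * y"
  using assms
proof (induction n rule: less_induct)
  case (less n)
  show ?case
  proof (cases "even n")
    case True
    then obtain m where m: "n = 2 * m" by auto
    then obtain f x y where *: "odd_pair x y" "dbl_D w m = 2 ^ f * x" "dbl_D v m = 2 ^ f * y"
      using less.IH[of m] less.prems by auto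
    then have "dbl_D w n = 2 ^ Suc f * (dbl_C w m * x)" "dbl_D v n = 2 ^ Suc f * (dbl_C v m * y)"
      by (simp_all add: m dbl_double)
    moreover have "odd_pair (dbl_C w m * x) (dbl_C v m * y)"
      using *(1) dbl_odd_C[of m] odd_pair_mult by blast
    ultimately show ?thesis by blast
  next
    case False
    then obtain m where m: "n = 2 * m + 1" by (auto elim: oddE)
    have "odd_pair (dbl_C w (2 * m) + 2 * ((2 * w - 1) * (dbl_C w m * dbl_D w m)))
        (dbl_C v (2 * m) + 2 * ((2 * v - 1) * (dbl_C v m * dbl_D v m)))"
      by (intro odd_pair_add_even conj_pair_intros dbl_odd_C[THEN conjunct1]
          dbl_odd_C[THEN conjunct2] odd_pair_imp_conj_pair)
    moreover have "dbl_D r n = dbl_C r (2 * m) + 2 * ((2 * r - 1) * (dbl_C r m * dbl_D r m))" for r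
      by (simp add: m dbl_double mult.assoc mult.left_commute)
    ultimately have "odd_pair (dbl_D w n) (dbl_D v n)" by simp
    then show ?thesis
      by (intro exI[of _ 0] exI[of _ "dbl_D w n"] exI[of _ "dbl_D v n"]) simp
  qed
qed

text \<open>If \<open>z\<^sup>2 = lehmer P (2 j)\<close>, the Pade approximants produce an element of \<open>\<int>[w]\<close> whose norm is
  less than \<open>1\<close> in absolute value, so it vanishes.\<close>
lemma pade_vanishes:
  fixes z :: int
  assumes z: "lehmer P (2 * j) = z\<^sup>2" "z > 0" and j: "j \<ge> 1"
  shows "\<exists>n\<ge>1. of_int z * pade_A w n = w ^ (j + 1) * pade_B w n \<and>
    of_int z * pade_A v n = v ^ (j + 1) * pade_B v n"
proof -
  define Z where "Z = real_of_int z"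
  define s t where "s = sqrt w" and "t = sqrt (w - 1)"
  have st: "s\<^sup>2 = w" "t\<^sup>2 = w - 1" "s > 0" "t > 0" using w1 by (simp_all add: s_def t_def)
  define q where "q = s * t"
  have q2: "q\<^sup>2 = w * (w - 1)" and q0: "q > 0" using st by (simp_all add: q_def power_mult_distrib)
  define \<omega> \<omega>' where "\<omega> = s + t" and "\<omega>' = s - t"
  have \<omega>: "w + q = s * \<omega>" "w - q = s * \<omega>'"
    using st(1) by (simp_all add: \<omega>_def \<omega>'_def q_def power2_eq_square algebra_simps)
  have \<omega>\<omega>': "\<omega> * \<omega>' = 1" using st(1,2) by (simp add: \<omega>_def \<omega>'_def power2_eq_square algebra_simps)
  have "t < s" by (simp add: s_def t_def)
  moreover have "s > 1" using w1 by (simp add: s_def)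
  ultimately have \<omega>_pos: "\<omega> > 1" "\<omega>' > 0" "\<omega> < 2 * s"
    using st(4) by (simp_all add: \<omega>_def \<omega>'_def)
  have v: "v > 0" "v < 1" "v = 1 / w" using v_bounds wv(2) w1 by (auto simp: field_simps)
  \<comment> \<open>The main term of Z: g^2 and Z^2 differ only by the tiny
    \<open>v ^ (2 * j) / (w - 1)\<close>.\<close>
  define g where "g = w ^ (j + 1) / q"
  have g0: "g > 0" using w1 q0 by (simp add: g_def)
  have g2: "g\<^sup>2 = w ^ (2 * j + 1) / (w - 1)"
    using w1 by (simp add: g_def power_divide q2 power_mult[symmetric] mult.commute field_simps)
      (simp add: power_add power2_eq_square)
  have Z2: "Z\<^sup>2 = (w ^ (2 * j + 1) - v ^ (2 * j)) / (w - 1)"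
    using lehmer_closed[OF wv, of "2 * j"] z(1) w1 by (simp add: Z_def field_simps)
  have gZ: "g\<^sup>2 - Z\<^sup>2 = v ^ (2 * j) / (w - 1)" by (simp add: g2 Z2 diff_divide_distrib)
  have "Z > 0" using z(2) by (simp add: Z_def)
  have "Z\<^sup>2 < g\<^sup>2" using gZ v(1) w1 by (smt (verit) divide_pos_pos zero_less_power)
  then have Zg: "Z < g" using g0 by (simp add: power2_less_imp_less)
  have "g\<^sup>2 > 1"
  proof -
    have "w \<le> w ^ (2 * j + 1)" using power_increasing[of 1 "2 * j + 1" w] w1 by simp
    then have "w - 1 < w ^ (2 * j + 1)" by linarith
    then show ?thesis unfolding g2 using w1 by (simp only: less_divide_eq_1_pos)
  qed
  obtain N where "g\<^sup>2 < \<omega> ^ N" using real_arch_pow[OF \<omega>_pos(1), of "g\<^sup>2"] by (elim exE)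
  \<comment> \<open>The order with \<omega>^n close to g^2 balances the two parts of E: (g - Z)
    \<omega>^n grows with n and (g + Z) \<omega>'^n decays.\<close>
  define n where "n = (LEAST n. g\<^sup>2 \<le> \<omega> ^ n)"
  have n1: "g\<^sup>2 \<le> \<omega> ^ n" unfolding n_def by (rule LeastI[of _ N]) (use \<open>g\<^sup>2 < \<omega> ^ N\<close> in simp)
  have "n \<noteq> 0" using n1 \<open>g\<^sup>2 > 1\<close> by (intro notI) simp
  then obtain n' where n': "n = Suc n'" by (cases n) auto
  have "\<not> g\<^sup>2 \<le> \<omega> ^ n'" unfolding n_def by (rule not_less_Least) (simp add: n' n_def[symmetric])
  then have n2: "\<omega> ^ n < \<omega> * g\<^sup>2" using \<omega>_pos(1) by (simp add: n')
  define E E' where "E = Z * pade_A w n - w ^ (j + 1) * pade_B w n"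
    and "E' = Z * pade_A v n - v ^ (j + 1) * pade_B v n"
  have conj: "conj_pair E E'"
    unfolding E_def E'_def Z_def using conj_pair_pade[of n]
    by (elim conjE) (intro conj_pair_intros)
  have E_eq: "E = s ^ n * ((Z - g) * \<omega> ^ n + (Z + g) * \<omega>' ^ n) / 2"
  proof -
    have 1: "pade_A w n + pade_B w n * q = s ^ n * \<omega> ^ n"
      using pade_closed[OF q2, of n] by (simp add: \<omega> power_mult_distrib)
    have 2: "pade_A w n + pade_B w n * (- q) = s ^ n * \<omega>' ^ n"
      using pade_closed[of "- q" w n] q2 by (simp add: \<omega> power_mult_distrib)
    have "w ^ (j + 1) = g * q" using q0 by (simp add: g_def)
    then have "E = Z * pade_A w n - g * (pade_B w n * q)" by (simp add: E_def)
    also have "pade_A w n = (s ^ n * \<omega> ^ n + s ^ n * \<omega>' ^ n) / 2" using 1 2 by simp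
    also have "pade_B w n * q = (s ^ n * \<omega> ^ n - s ^ n * \<omega>' ^ n) / 2" using 1 2 by simp
    finally show ?thesis by (simp add: algebra_simps add_divide_distrib diff_divide_distrib)
  qed
  have "v * w = 1" using wv(2) by (simp add: mult.commute)
  \<comment> \<open>Cauchy-Schwarz for the form a^2 + c b^2, which is positive definite at v because
    0 < v < 1; by \<open>pade_norm\<close> its value is v^n. The defect, multiplied by c, is an
    explicit square.\<close>
  have E'_le: "E'\<^sup>2 \<le> g\<^sup>2 * v ^ n"
  proof -
    define c where "c = v * (1 - v)"
    have c0: "c > 0" using v by (simp add: c_def)
    have N: "(pade_A v n)\<^sup>2 + c * (pade_B v n)\<^sup>2 = v ^ n"
      using pade_norm[of v n] by (simp add: c_def algebra_simps)
    define x y where "x = v ^ (j + 1)" and "y = v ^ (2 * j) / (w - 1)"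
    have "v * (v * w) = v" using \<open>v * w = 1\<close> by simp
    then have "c = v\<^sup>2 * (w - 1)" by (simp add: c_def power2_eq_square algebra_simps)
    moreover have "x\<^sup>2 = v ^ (2 * j) * v\<^sup>2"
      by (simp add: x_def power2_eq_square power_mult power_mult_distrib)
    ultimately have cy: "c * y = x\<^sup>2" using w1 by (simp add: y_def)
    have y: "Z\<^sup>2 + y = g\<^sup>2" using gZ by (simp add: y_def)
    define a b where "a = pade_A v n" and "b = pade_B v n"
    have "c * ((Z\<^sup>2 + y) * (a\<^sup>2 + c * b\<^sup>2) - (Z * a - x * b)\<^sup>2)
        = (c * Z\<^sup>2 + c * y) * (a\<^sup>2 + c * b\<^sup>2) - c * (Z * a - x * b)\<^sup>2"
      by (simp add: distrib_left[symmetric] right_diff_distrib mult.assoc)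
    also have "\<dots> = (Z * c * b + x * a)\<^sup>2"
      unfolding cy by (simp add: power2_eq_square algebra_simps)
    finally have "0 \<le> c * ((Z\<^sup>2 + y) * (a\<^sup>2 + c * b\<^sup>2) - (Z * a - x * b)\<^sup>2)" by simp
    then have "(Z * a - x * b)\<^sup>2 \<le> (Z\<^sup>2 + y) * (a\<^sup>2 + c * b\<^sup>2)"
      using c0 by (simp add: zero_le_mult_iff)
    then show ?thesis unfolding y a_def b_def N by (simp add: E'_def x_def)
  qed
  have "\<bar>E'\<bar> * s ^ n \<le> g"
  proof (rule power2_le_imp_le)
    have "(s ^ n)\<^sup>2 = w ^ n" by (metis power_mult mult.commute st(1))
    then have "(\<bar>E'\<bar> * s ^ n)\<^sup>2 = E'\<^sup>2 * w ^ n" by (simp only: power_mult_distrib power2_abs)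
    also have "\<dots> \<le> (g\<^sup>2 * v ^ n) * w ^ n" using E'_le w1 by (intro mult_right_mono) auto
    also have "\<dots> = g\<^sup>2" using \<open>v * w = 1\<close>
      by (simp only: mult.assoc power_mult_distrib[symmetric] power_one mult_1_right)
    finally show "(\<bar>E'\<bar> * s ^ n)\<^sup>2 \<le> g\<^sup>2" .
  qed (use g0 in simp)
  define R where "R = (Z - g) * \<omega> ^ n + (Z + g) * \<omega>' ^ n"
  have R: "g * \<bar>R\<bar> < 2"
  proof -
    have p: "\<omega> ^ n > 0" "\<omega>' ^ n > 0" using \<omega>_pos by simp_all
    have "\<omega> ^ n * \<omega>' ^ n = 1" using \<omega>\<omega>' by (simp flip: power_mult_distrib)
    then have "g\<^sup>2 * \<omega>' ^ n \<le> 1"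
      using mult_right_mono[OF n1, of "\<omega>' ^ n"] p by simp
    moreover have "g * ((Z + g) * \<omega>' ^ n) < 2 * (g\<^sup>2 * \<omega>' ^ n)"
    proof -
      have "g * (Z + g) < 2 * g\<^sup>2" using Zg g0 by (simp add: power2_eq_square)
      then show ?thesis using p by (simp add: mult.assoc[symmetric])
    qed
    ultimately have 1: "g * ((Z + g) * \<omega>' ^ n) < 2" by linarith
    \<comment> \<open>The growing part: g (g - Z) is at most g^2 - Z^2, and minimality of n bounds
      \<omega>^n by \<omega> g^2.\<close>
    have "g * (g - Z) \<le> (g + Z) * (g - Z)" using Zg \<open>Z > 0\<close> by (intro mult_right_mono) auto
    also have "\<dots> = v ^ (2 * j) / (w - 1)" using gZ by (simp add: power2_eq_square algebra_simps)
    finally have h: "g * (g - Z) \<le> v ^ (2 * j) / (w - 1)" .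
    have "g * ((g - Z) * \<omega> ^ n) = (g * (g - Z)) * \<omega> ^ n" by (simp only: mult.assoc)
    also have "\<dots> \<le> v ^ (2 * j) / (w - 1) * \<omega> ^ n"
      by (rule mult_right_mono[OF h less_imp_le[OF p(1)]])
    also have "\<dots> < v ^ (2 * j) / (w - 1) * (\<omega> * g\<^sup>2)"
      by (rule mult_strict_left_mono[OF n2]) (use v(1) w1 in simp)
    also have "\<dots> = (v ^ (2 * j) * w ^ (2 * j)) * (\<omega> * w) / (w - 1)\<^sup>2"
      unfolding g2 by (simp add: power2_eq_square)
    also have "v ^ (2 * j) * w ^ (2 * j) = 1"
      by (simp only: power_mult_distrib[symmetric] \<open>v * w = 1\<close> power_one)
    \<comment> \<open>Here P >= 4 enters: w = P - v <= (P - 2)^2 gives s <= P - 2, while \<omega> <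
      2 s and w (P - 2) = (w - 1)^2.\<close>
    also have "1 * (\<omega> * w) / (w - 1)\<^sup>2 \<le> 2"
    proof -
      have "s \<le> of_int P - 2"
      proof (rule power2_le_imp_le)
        have "of_int P \<ge> (4 :: real)" using P(1) by linarith
        then have "of_int P \<le> (of_int P - 2 :: real)\<^sup>2"
          using mult_nonneg_nonneg[of "of_int P - 4 :: real" "of_int P - 1"]
          by (simp add: power2_eq_square algebra_simps)
        then show "s\<^sup>2 \<le> (of_int P - 2)\<^sup>2" using st(1) v(1) wv(1) by linarith
      qed (use P(1) in simp)
      then have "\<omega> * w \<le> 2 * (w * (of_int P - 2))" using \<omega>_pos(3) w1 by simp
      also have "w * (of_int P - 2) = (w - 1)\<^sup>2"
        using wv by (simp add: power2_eq_square algebra_simps flip: wv(1))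
      finally show ?thesis using w1 by (simp add: divide_le_eq)
    qed
    finally have 2: "g * ((g - Z) * \<omega> ^ n) < 2" .
    \<comment> \<open>Both parts are positive and below 2, so their difference is below 2 in
      absolute value.\<close>
    have "g * R = g * ((Z + g) * \<omega>' ^ n) - g * ((g - Z) * \<omega> ^ n)"
      by (simp add: R_def algebra_simps)
    moreover have "g * ((Z + g) * \<omega>' ^ n) > 0" "g * ((g - Z) * \<omega> ^ n) > 0"
      using p g0 Zg \<open>Z > 0\<close> by simp_all
    ultimately have "\<bar>g * R\<bar> < 2" using 1 2 by linarith
    then show ?thesis using g0 by (simp add: abs_mult)
  qed
  have "\<bar>E * E'\<bar> = (\<bar>E'\<bar> * s ^ n) * \<bar>R\<bar> / 2"
    using st(3) by (simp add: E_eq abs_mult R_def)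
  also have "\<dots> \<le> g * \<bar>R\<bar> / 2" using \<open>\<bar>E'\<bar> * s ^ n \<le> g\<close> by (intro divide_right_mono mult_right_mono) auto
  also have "\<dots> < 1" using R by simp
  finally have "\<bar>E * E'\<bar> < 1" .
  moreover obtain k :: int where "E * E' = of_int k" using conj_pair_norm[OF conj] by blast
  ultimately have "E * E' = 0" by simp
  then have "E = 0 \<and> E' = 0" by (rule conj_pair_eq_0_iff[OF conj])
  then have "Z * pade_A w n = w ^ (j + 1) * pade_B w n" "Z * pade_A v n = v ^ (j + 1) * pade_B v n"
    unfolding E_def E'_def by linarith+
  moreover have "n \<ge> 1" using n' by linarith
  ultimately show ?thesis unfolding Z_def by blast
qed

text \<open>The norm identity forces \<open>odd_A w M\<close> = w^(2j) and \<open>odd_B w M\<close>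
  = z w^j. Comparing these with 1 and \<plusminus>1, cancelling the common power of 2 and taking
  norms gives z^2 m = (1 + 2 c)^2 (P + 2) with z and m odd, impossible for even P.\<close>

lemma odd_index_square_imp:
  fixes z :: int
  assumes z: "lehmer P (2 * j) = z\<^sup>2" "z > 0" and j: "j \<ge> 1"
    and n: "of_int z * odd_A w M = w ^ j * odd_B w M"
  shows False
proof -
  define Z where "Z = real_of_int z"
  have Z0: "Z > 0" using z(2) by (simp add: Z_def)
  have vw: "v * w = 1" using wv(2) by (simp add: mult.commute)
  have vwk: "v ^ k * w ^ k = 1" for k
    by (simp only: power_mult_distrib[symmetric] vw power_one)
  have odd_z: "odd z" using odd_lehmer[OF P(2), of "2 * j"] z(1) by simp
  define a b where "a = odd_A w M" and "b = odd_B w M"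
  have a0: "a > 0" using dbl_nonneg[OF w1, of M] w1 by (simp add: a_def odd_A_def add_pos_nonneg)
  have N: "w * a\<^sup>2 - (w - 1) * b\<^sup>2 = 1"
    using dbl_norm[of w M] by (simp add: a_def b_def odd_A_def odd_B_def power2_eq_square algebra_simps)
  have Z2: "(w - 1) * Z\<^sup>2 = w ^ (2 * j + 1) - v ^ (2 * j)"
    using lehmer_closed[OF wv, of "2 * j"] z(1) by (simp add: Z_def)
  have "Z * a = w ^ j * b" using n by (simp add: Z_def a_def b_def)
  then have Zab: "Z\<^sup>2 * a\<^sup>2 = w ^ (2 * j) * b\<^sup>2"
    by (metis power_mult power_mult_distrib mult.commute)
  \<comment> \<open>Elimination of b and Z leaves an equation for a alone, which yields a^2 =
    w^(4j).\<close>
  have "w ^ (2 * j) * (w * a\<^sup>2 - 1) = w ^ (2 * j) * ((w - 1) * b\<^sup>2)" using N by simp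
  also have "\<dots> = (w - 1) * Z\<^sup>2 * a\<^sup>2" using Zab by (simp only: mult.assoc mult.left_commute)
  also have "\<dots> = (w ^ (2 * j + 1) - v ^ (2 * j)) * a\<^sup>2" by (simp only: Z2)
  finally have "v ^ (2 * j) * a\<^sup>2 = w ^ (2 * j)" by (simp add: algebra_simps)
  then have h: "v ^ (2 * j) * a\<^sup>2 = w ^ (2 * j)" .
  have "a\<^sup>2 = (v ^ (2 * j) * w ^ (2 * j)) * a\<^sup>2" by (simp only: vwk mult_1)
  also have "\<dots> = w ^ (2 * j) * (v ^ (2 * j) * a\<^sup>2)" by (simp only: mult.commute mult.left_commute)
  also have "\<dots> = (w ^ (2 * j))\<^sup>2" by (simp only: h) (simp only: power2_eq_square)
  finally have "a\<^sup>2 = (w ^ (2 * j))\<^sup>2" .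
  then have a: "a = w ^ (2 * j)" using a0 w1 by (simp add: power2_eq_iff_nonneg)
  have sq: "r ^ (2 * j) = r ^ j * r ^ j" for r :: real by (simp add: mult_2 power_add)
  have "w ^ j * b = w ^ j * (Z * w ^ j)"
    using \<open>Z * a = w ^ j * b\<close> unfolding a sq by (simp only: mult.commute mult.left_commute)
  then have b: "b = Z * w ^ j" using w1 by simp
  have a': "odd_A v M = v ^ (2 * j)"
  proof (rule conj_pair_unique)
    show "conj_pair a (odd_A v M)" unfolding a_def using odd_pair_odd_AB(1) by blast
    show "conj_pair a (v ^ (2 * j))" unfolding a by (intro conj_pair_intros)
  qed
  have b': "odd_B v M = Z * v ^ j"
  proof (rule conj_pair_unique)
    show "conj_pair b (odd_B v M)" unfolding b_def using odd_pair_odd_AB(2) by blast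
    show "conj_pair b (Z * v ^ j)" unfolding b Z_def by (intro conj_pair_intros)
  qed
  define q where "q = M div 2"
  \<comment> \<open>With index t and sign e the formulas for even and odd M take one form.\<close>
  define t where "t = (if even M then q else q + 1)"
  define e :: real where "e = (if even M then 1 else -1)"
  have ab: "odd_A r M - 1 = 4 * (r - 1) * dbl_D r t * odd_B r q"
    "odd_B r M - e = 4 * r * dbl_D r t * odd_A r q" for r
  proof -
    have "odd_A r M - 1 = 4 * (r - 1) * dbl_D r t * odd_B r q \<and>
      odd_B r M - e = 4 * r * dbl_D r t * odd_A r q"
    proof (cases "even M")
      case True
      then have "M = 2 * q" by (simp add: q_def)
      then show ?thesis using odd_AB_even[of r q] True by (simp add: t_def e_def)
    next
      case False
      then have "M = 2 * q + 1" by (simp add: q_def)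
      then show ?thesis using odd_AB_odd[of r q] False by (simp add: t_def e_def)
    qed
    then show "odd_A r M - 1 = 4 * (r - 1) * dbl_D r t * odd_B r q"
      "odd_B r M - e = 4 * r * dbl_D r t * odd_A r q" by blast+
  qed
  have "t \<ge> 1"
  proof (rule ccontr)
    assume "\<not> t \<ge> 1"
    then have "t = 0" by simp
    then have "a = 1" using ab(1)[of w] by (simp add: a_def)
    moreover have "w ^ (2 * j) > 1" using w1 j by (intro one_less_power) auto
    ultimately show False using a by simp
  qed
  then obtain f x y where D: "odd_pair x y" "dbl_D w t = 2 ^ f * x" "dbl_D v t = 2 ^ f * y"
    using dbl_D_decompose by blast
  \<comment> \<open>F collects the explicit 4 and the power of 2 in \<open>dbl_D\<close>; the
    cofactors k and l below are odd.\<close>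
  define F :: real where "F = 4 * 2 ^ f"
  have F0: "F > 0" by (simp add: F_def)
  define k k' where "k = x * odd_B w q" and "k' = y * odd_B v q"
  have k: "odd_pair k k'" unfolding k_def k'_def using D(1) odd_pair_odd_AB by blast
  define l l' where "l = x * odd_A w q" and "l' = y * odd_A v q"
  have l: "odd_pair l l'" unfolding l_def l'_def using D(1) odd_pair_odd_AB by blast
  have A: "w ^ (2 * j) - 1 = F * ((w - 1) * k)" "v ^ (2 * j) - 1 = F * ((v - 1) * k')"
    using ab(1)[of w] ab(1)[of v] unfolding a' a[unfolded a_def]
    by (simp_all add: D F_def k_def k'_def mult.left_commute)
  have B: "Z * w ^ j - e = F * (w * l)" "Z * v ^ j - e = F * (v * l')"
    using ab(2)[of w] ab(2)[of v] unfolding b' b[unfolded b_def]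
    by (simp_all add: D F_def l_def l'_def mult.left_commute)
  obtain s s' where s: "conj_pair s s'" "l = 1 + 2 * s" "l' = 1 + 2 * s'"
    using l unfolding odd_pair_def by blast
  obtain c :: int where c: "w * s - v * s' = of_int c * (w - v)"
    using conj_pair_diff_multiple[OF conj_pair_mult[OF conj_pair_w s(1)]] by blast
  \<comment> \<open>Subtracting the conjugate equation removes e, and since l is odd, w l - v l' is
    an odd multiple of w - v.\<close>
  have "Z * (w ^ j - v ^ j) = F * (w * l - v * l')"
    using B by (simp add: algebra_simps)
  also have "w * l - v * l' = (w - v) + 2 * (w * s - v * s')"
    by (simp add: s algebra_simps)
  also have "\<dots> = (1 + 2 * of_int c) * (w - v)" unfolding c by (simp add: algebra_simps)
  finally have U: "Z * (w ^ j - v ^ j) = F * ((1 + 2 * of_int c) * (w - v))" .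
  have fac: "w ^ (2 * j) - 1 = w ^ j * (w ^ j - v ^ j)" "v ^ (2 * j) - 1 = - (v ^ j * (w ^ j - v ^ j))"
    using vwk[of j] unfolding sq by (simp_all add: right_diff_distrib mult.commute)
  have "F * (Z * ((w - 1) * k)) = w ^ j * (Z * (w ^ j - v ^ j))"
    using A(1) fac(1) by (simp add: mult.left_commute)
  also have "\<dots> = F * (w ^ j * ((1 + 2 * of_int c) * (w - v)))"
    unfolding U by (simp only: mult.left_commute)
  finally have 1: "Z * ((w - 1) * k) = w ^ j * ((1 + 2 * of_int c) * (w - v))" using F0 by simp
  have "F * (Z * ((v - 1) * k')) = Z * (v ^ (2 * j) - 1)"
    unfolding A(2) by (simp only: mult.left_commute)
  also have "\<dots> = - (v ^ j * (Z * (w ^ j - v ^ j)))"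
    unfolding fac(2) by (simp add: mult.left_commute)
  also have "\<dots> = F * - (v ^ j * ((1 + 2 * of_int c) * (w - v)))"
    unfolding U by (simp only: mult.left_commute mult_minus_right)
  finally have 2: "Z * ((v - 1) * k') = - (v ^ j * ((1 + 2 * of_int c) * (w - v)))"
    using F0 by (metis mult_left_cancel less_irrefl)
  obtain m where m: "odd m" "k * k' = of_int m" using odd_pair_norm[OF k] by blast
  \<comment> \<open>Taking norms: the powers of w and v cancel, and both sides will contain the
    factor P - 2.\<close>
  have "(Z * ((w - 1) * k)) * (Z * ((v - 1) * k'))
      = - ((v ^ j * w ^ j) * ((1 + 2 * of_int c)\<^sup>2 * (w - v)\<^sup>2))"
    unfolding 1 2 by (simp add: power2_eq_square mult.commute mult.left_commute)
  then have H: "Z\<^sup>2 * ((w - 1) * (v - 1)) * (k * k') = - ((1 + 2 * of_int c)\<^sup>2 * (w - v)\<^sup>2)"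
    unfolding vwk by (simp add: power2_eq_square mult.commute mult.left_commute)
  have 3: "(w - 1) * (v - 1) = - (of_int P - 2)"
    using wv(2) by (simp add: algebra_simps flip: wv(1))
  have 4: "(w - v)\<^sup>2 = (of_int P - 2) * (of_int P + 2)"
    using wv(2) by (simp add: power2_eq_square algebra_simps flip: wv(1))
  have "X * (- D) * Y = - (R * (D * S)) \<Longrightarrow> D * (X * Y) = D * (R * S)" for X D Y R S :: real
    by (simp add: mult.commute mult.left_commute)
  from this[OF H[unfolded 3 4]] have "(of_int P - 2) * (Z\<^sup>2 * of_int m)
      = (of_int P - 2) * ((1 + 2 * of_int c)\<^sup>2 * (of_int P + 2))" unfolding m(2) .
  moreover have "(of_int P - 2 :: real) \<noteq> 0" using P(1) by linarith
  ultimately have "Z\<^sup>2 * of_int m = (1 + 2 * of_int c)\<^sup>2 * (of_int P + 2)" by simp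
  then have "real_of_int (z\<^sup>2 * m) = of_int ((1 + 2 * c)\<^sup>2 * (P + 2))" by (simp add: Z_def)
  then have "z\<^sup>2 * m = (1 + 2 * c)\<^sup>2 * (P + 2)" by linarith
  moreover have "odd (z\<^sup>2 * m)" using odd_z m(1) by simp
  ultimately show False using P(2) by simp
qed

text \<open>An even order n already fails by parity: the norm of z \<open>dbl_C\<close> is odd, that
  of 2 w^(j+1) \<open>dbl_D\<close> divisible by 4. An odd order is the previous lemma.\<close>

lemma lehmer_even_not_square:
  fixes z :: int
  assumes z: "lehmer P (2 * j) = z\<^sup>2" "z > 0" and j: "j \<ge> 1"
  shows False
proof -
  obtain n where n: "n \<ge> 1" "of_int z * pade_A w n = w ^ (j + 1) * pade_B w n"
    "of_int z * pade_A v n = v ^ (j + 1) * pade_B v n"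
    using pade_vanishes[OF assms] by blast
  have v0: "v > 0" using v_bounds by simp
  show False
  proof (cases "even n")
    case True
    then obtain M where M: "n = 2 * M" by auto
    have "of_int z * dbl_C r M = 2 * r ^ (j + 1) * dbl_D r M"
      if "r > 0" "of_int z * pade_A r n = r ^ (j + 1) * pade_B r n" for r
    proof -
      have "r ^ M * (of_int z * dbl_C r M) = r ^ M * (2 * r ^ (j + 1) * dbl_D r M)"
        using that(2) pade_even[of r M] by (simp add: M mult.left_commute mult.assoc)
      then show ?thesis using that(1) by simp
    qed
    from this[OF _ n(2)] this[OF _ n(3)] have
      *: "of_int z * dbl_C w M = 2 * w ^ (j + 1) * dbl_D w M"
      "of_int z * dbl_C v M = 2 * v ^ (j + 1) * dbl_D v M" using w1 v0 by auto
    have "(of_int z * dbl_C w M) * (of_int z * dbl_C v M)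
        = 4 * (w ^ (j + 1) * v ^ (j + 1)) * (dbl_D w M * dbl_D v M)"
      unfolding * by (simp add: mult.left_commute mult.assoc)
    also have "w ^ (j + 1) * v ^ (j + 1) = 1"
      by (simp only: power_mult_distrib[symmetric] wv(2) power_one)
    finally have "(of_int z)\<^sup>2 * (dbl_C w M * dbl_C v M) = 4 * (dbl_D w M * dbl_D v M)"
      by (simp add: power2_eq_square mult.left_commute mult.assoc)
    moreover obtain m where m: "odd m" "dbl_C w M * dbl_C v M = of_int m"
      using odd_pair_norm[OF dbl_odd_C[THEN conjunct1]] by blast
    moreover obtain d :: int where "dbl_D w M * dbl_D v M = of_int d"
      using conj_pair_norm[OF dbl_odd_C[THEN conjunct2]] by blast
    ultimately have "real_of_int (z\<^sup>2 * m) = of_int (4 * d)" by simp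
    then have "z\<^sup>2 * m = 4 * d" by linarith
    moreover have "odd (z\<^sup>2 * m)" using odd_lehmer[OF P(2), of "2 * j"] z(1) m(1) by simp
    ultimately show False by simp
  next
    case False
    then obtain M where M: "n = 2 * M + 1" by (auto elim: oddE)
    have "w ^ Suc M * (of_int z * odd_A w M) = w ^ Suc M * (w ^ j * odd_B w M)"
      using n(2) unfolding M pade_odd by (simp add: mult.left_commute mult.assoc)
    then have "of_int z * odd_A w M = w ^ j * odd_B w M" using w1 by simp
    then show False by (rule odd_index_square_imp[OF assms])
  qed
qed

end

lemma lehmer_even_square:
  assumes P: "P \<ge> 4" "even P" and z: "lehmer P (2 * j) = z\<^sup>2"
  shows "j = 0"
proof (rule ccontr)
  assume "j \<noteq> 0"
  have "P \<ge> 3" using P(1) by simp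
  then obtain x y :: real where xy: "x > 1" "x + y = of_int P" "x * y = 1"
    using lucas_roots by metis
  interpret quadratic_unit P x y using P xy by unfold_locales
  have "lehmer P (2 * j) = \<bar>z\<bar>\<^sup>2" using z by simp
  moreover have "z \<noteq> 0" using lehmer_pos[of P "2 * j"] P(1) z by auto
  ultimately show False using lehmer_even_not_square[of j "\<bar>z\<bar>"] \<open>j \<noteq> 0\<close> by simp
qed

section \<open>Dyadic moduli\<close>

text \<open>Powers of 2 in t contribute 1 because v is 7 modulo 8. For the odd part g, the
  reciprocity sign and \<open>Jacobi (-1) g\<close> agree and cancel.\<close>

lemma Jacobi_eq_one_of_cong_minus_one:
  assumes "v > 0" "v mod 8 = 7" "t > 0" "[v = -1] (mod t)"
  shows "Jacobi t v = 1"
proof -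
  have v: "odd v" "v mod 4 = 3" using assms(2) by presburger+
  have "nat t > 0" using assms(3) by simp
  then obtain r g where "nat t = 2 ^ r * g" and g: "odd g" by (rule even_decompose)
  then have t: "t = 2 ^ r * int g" using assms(3) by (metis of_nat_mult of_nat_numeral of_nat_power int_nat_eq less_le_not_le)
  have g0: "int g > 0" "odd (int g)" using g by (auto intro: Nat.gr0I)
  have "Jacobi (2 ^ r) v = 1"
    by (induction r) (use v assms(1,2) in \<open>auto simp: Jacobi_mult_left Jacobi_two\<close>)
  then have "Jacobi t v = Jacobi (int g) v"
    by (simp add: t Jacobi_mult_left v)
  also have "\<dots> = (if int g mod 4 = 3 then -1 else 1) * Jacobi v (int g)"
    using Jacobi_reciprocity[OF g0 assms(1) v(1)] v(2) by simp
  also have "Jacobi v (int g) = Jacobi (-1) (int g)"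
    by (rule Jacobi_cong) (use assms(4) t in \<open>auto intro: cong_dvd_modulus\<close>)
  finally show ?thesis using Jacobi_minus_one[OF g0] by auto
qed

lemma Jacobi_eq_one_of_cong_one:
  assumes "v > 0" "v mod 8 = 1" "t > 0" "[v = 1] (mod t)"
  shows "Jacobi t v = 1"
proof -
  have v: "odd v" "v mod 4 = 1" using assms(2) by presburger+
  have "nat t > 0" using assms(3) by simp
  then obtain r g where "nat t = 2 ^ r * g" and g: "odd g" by (rule even_decompose)
  then have t: "t = 2 ^ r * int g" using assms(3) by (metis of_nat_mult of_nat_numeral of_nat_power int_nat_eq less_le_not_le)
  have g0: "int g > 0" "odd (int g)" using g by (auto intro: Nat.gr0I)
  have "Jacobi (2 ^ r) v = 1"
    by (induction r) (use v assms(1,2) in \<open>auto simp: Jacobi_mult_left Jacobi_two\<close>)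
  then have "Jacobi t v = Jacobi (int g) v"
    by (simp add: t Jacobi_mult_left v)
  also have "\<dots> = Jacobi v (int g)"
    using Jacobi_reciprocity[OF g0 assms(1) v(1)] v(2) by simp
  also have "Jacobi v (int g) = Jacobi 1 (int g)"
    by (rule Jacobi_cong) (use assms(4) t in \<open>auto intro: cong_dvd_modulus\<close>)
  finally show ?thesis using g0 by simp
qed

lemma Jacobi_uminus:
  assumes "n > 0" "odd n"
  shows "Jacobi (- a) n = (if n mod 4 = 3 then -1 else 1) * Jacobi a n"
  using Jacobi_mult_left[OF assms(2), of "-1" a] Jacobi_minus_one[OF assms] by simp

text \<open>The moduli \<open>dyadic_V P r = t\<^sup>2\<^sup>m + t\<^sup>-\<^sup>2\<^sup>m\<close> with \<open>m = 2\<^sup>r\<close>.\<close>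
definition dyadic_V :: "int \<Rightarrow> nat \<Rightarrow> int" where
  "dyadic_V P r = lucas_V P (2 ^ r)"

lemma dyadic_V_0 [simp]: "dyadic_V P 0 = P"
  by (simp add: dyadic_V_def)

lemma dyadic_V_Suc: "P \<ge> 3 \<Longrightarrow> dyadic_V P (Suc r) = (dyadic_V P r)\<^sup>2 - 2"
  by (simp add: dyadic_V_def lucas_V_double)

lemma dyadic_V_ge: "P \<ge> 3 \<Longrightarrow> dyadic_V P r \<ge> 3"
  by (simp add: dyadic_V_def lucas_V_ge)

lemma square_mod_8: "odd (n::int) \<Longrightarrow> n\<^sup>2 mod 8 = 1"
proof -
  assume "odd n"
  then have "n mod 8 = 1 \<or> n mod 8 = 3 \<or> n mod 8 = 5 \<or> n mod 8 = 7" by presburger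
  then show ?thesis by (auto simp: power2_eq_square mod_mult_eq[of n 8 n, symmetric])
qed

lemma dyadic_V_odd:
  assumes "P \<ge> 3" "odd P"
  shows "odd (dyadic_V P r)" "dyadic_V P (Suc r) mod 8 = 7"
proof -
  show odd: "odd (dyadic_V P r)" for r
    by (induction r) (use assms in \<open>auto simp: dyadic_V_Suc\<close>)
  show "dyadic_V P (Suc r) mod 8 = 7"
    using square_mod_8[OF odd[of r]] assms(1) by (simp add: dyadic_V_Suc) presburger
qed

text \<open>Modulo \<open>P + 1\<close> and \<open>P - 1\<close> the number \<open>t\<^sup>2\<close> is a primitive cube,
  respectively sixth, root of unity.\<close>
lemma dyadic_V_cong_minus_one:
  assumes "P \<ge> 3"
  shows "[dyadic_V P (Suc r) = -1] (mod (P + 1))" "[dyadic_V P (Suc r) = -1] (mod (P - 1))"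
proof -
  show "[dyadic_V P (Suc r) = -1] (mod (P + 1))"
  proof (induction r)
    case 0
    have "P\<^sup>2 - 2 - (-1) = (P + 1) * (P - 1)" by (simp add: power2_eq_square algebra_simps)
    then show ?case using assms by (simp add: dyadic_V_Suc cong_iff_dvd_diff)
  next
    case (Suc r)
    then have "[(dyadic_V P (Suc r))\<^sup>2 - 2 = (-1)\<^sup>2 - 2] (mod (P + 1))"
      by (intro cong_diff cong_pow) auto
    then show ?case using assms by (simp add: dyadic_V_Suc[of P "Suc r"])
  qed
  show "[dyadic_V P (Suc r) = -1] (mod (P - 1))"
  proof (induction r)
    case 0
    have "P\<^sup>2 - 2 - (-1) = (P - 1) * (P + 1)" by (simp add: power2_eq_square algebra_simps)
    then show ?case using assms by (simp add: dyadic_V_Suc cong_iff_dvd_diff)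
  next
    case (Suc r)
    then have "[(dyadic_V P (Suc r))\<^sup>2 - 2 = (-1)\<^sup>2 - 2] (mod (P - 1))"
      by (intro cong_diff cong_pow) auto
    then show ?case using assms by (simp add: dyadic_V_Suc[of P "Suc r"])
  qed
qed

lemma Jacobi_dyadic_V_odd:
  assumes "P \<ge> 3" "odd P"
  shows "Jacobi (- 1) (dyadic_V P (Suc r)) = -1"
    and "Jacobi (- (P + 1)) (dyadic_V P (Suc r)) = -1"
    and "Jacobi (- (P - 1)) (dyadic_V P (Suc r)) = -1"
proof -
  define v where "v = dyadic_V P (Suc r)"
  have v: "v > 0" "v mod 8 = 7"
    using dyadic_V_ge[OF assms(1), of "Suc r"] dyadic_V_odd[OF assms, of r] by (auto simp: v_def)
  then have v': "odd v" "v mod 4 = 3" by presburger+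
  show "Jacobi (- 1) v = -1" using Jacobi_minus_one[OF v(1) v'(1)] v'(2) by simp
  have "Jacobi (P + 1) v = 1" "Jacobi (P - 1) v = 1"
    using dyadic_V_cong_minus_one[OF assms(1), of r] assms(1) v
    by (auto intro!: Jacobi_eq_one_of_cong_minus_one simp: v_def)
  then show "Jacobi (- (P + 1)) v = -1" "Jacobi (- (P - 1)) v = -1"
    using Jacobi_uminus[OF v(1) v'(1), of "P + 1"] Jacobi_uminus[OF v(1) v'(1), of "P - 1"] v'(2)
    by simp_all
qed

text \<open>The divisor n allows passing from an even \<open>dyadic_V\<close> to its odd
  half.\<close>

lemma square_not_cong:
  assumes "x = z\<^sup>2" "[x = a] (mod v)" "n dvd v" "odd n" "Jacobi a n = -1"
  shows False
proof -
  have "[z\<^sup>2 = a] (mod n)" using assms(1-3) by (auto intro: cong_dvd_modulus)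
  then show False using Jacobi_square_nonneg[OF assms(4)] assms(5) by blast
qed

text \<open>Write \<open>n \<equiv> e \<equiv> \<plusminus>1\<close> modulo \<open>4\<close> with \<open>n = e + 2 m g\<close>, \<open>m\<close> a power of \<open>2\<close> and \<open>g\<close> odd.\<close>
lemma lucas_V_cong_odd_index:
  assumes P: "P \<ge> 3" and n: "odd n" "n \<noteq> 1"
  obtains r where "[lucas_V P n = - P] (mod dyadic_V P (Suc r))"
proof (cases "n mod 4 = 1")
  case True
  then have "(n - 1) div 4 > 0" using n by presburger
  then obtain r g where rg: "(n - 1) div 4 = 2 ^ r * g" "odd g" by (rule even_decompose)
  moreover have "n = 1 + 4 * ((n - 1) div 4)" using True by presburger
  ultimately have "n = 1 + 2 * 2 ^ Suc r * g" by simp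
  then have "[lucas_V P n = (-1) ^ g * lucas_V P 1] (mod dyadic_V P (Suc r))"
    using lucas_V_cong_step[OF P, of 1 "2 ^ Suc r" g] by (simp add: dyadic_V_def)
  then show ?thesis using rg(2) that by simp
next
  case False
  then have n4: "n mod 4 = 3" using n by presburger
  then have "(n + 1) div 4 > 0" by presburger
  then obtain r g where rg: "(n + 1) div 4 = 2 ^ r * g" "odd g" by (rule even_decompose)
  define m where "m = (2::nat) ^ Suc r"
  have m: "m \<ge> 2" by (simp add: m_def)
  obtain h where h: "g = Suc (2 * h)" using rg(2) by (auto elim: oddE)
  have "n + 1 = 4 * ((n + 1) div 4)" using n4 by presburger
  then have "n + 1 = 2 * m * g" unfolding rg(1) m_def by simp
  \<comment> \<open>For e = -1 the index 2 m - 1 stands in for -1: an even number of shifts remains,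
    and \<open>lucas_V P (2 * m - 1)\<close> is -P modulo \<open>lucas_V P m\<close>.\<close>
  then have n_eq: "n = (2 * m - 1) + 2 * m * (2 * h)" using h m by (simp add: algebra_simps)
  have "[lucas_V P n = lucas_V P (2 * m - 1)] (mod lucas_V P m)"
    using lucas_V_cong_step[OF P, of "2 * m - 1" m "2 * h"] n_eq by simp
  moreover have "lucas_V P (2 * m - 1) - (- P) = lucas_V P m * lucas_V P (m - 1)"
    using lucas_V_add_twice[OF P, of 1 "m - 1"] m
    by (simp add: mult.commute diff_mult_distrib2 Suc_diff_Suc numeral_2_eq_2)
  ultimately have "[lucas_V P n = - P] (mod lucas_V P m)"
    by (metis cong_iff_dvd_diff cong_trans dvd_triv_left)
  then show ?thesis using that by (simp add: m_def dyadic_V_def)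
qed

text \<open>The halves u satisfy u' = 2 u^2 - 1. The first step starts from P / 2, a multiple of 4,
  and gives -1 modulo 8; from then on u is odd and the value is 1 modulo 8.\<close>

lemma dyadic_V_half:
  assumes "P \<ge> 3" "P mod 8 = 0"
  shows "even (dyadic_V P r)" "(dyadic_V P 1 div 2) mod 8 = 7"
    "(dyadic_V P (Suc (Suc r)) div 2) mod 8 = 1"
proof -
  obtain q where q: "P = 8 * q" using assms(2) by auto
  show ev: "even (dyadic_V P r)" for r
    using assms by (induction r) (auto simp: dyadic_V_Suc q)
  have 1: "dyadic_V P 1 = 2 * (32 * q\<^sup>2 - 1)"
    using dyadic_V_Suc[OF assms(1), of 0] by (simp add: q power2_eq_square)
  then show *: "(dyadic_V P 1 div 2) mod 8 = 7" by simp presburger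
  have odd: "odd (dyadic_V P (Suc r) div 2)" for r
  proof -
    obtain u where "dyadic_V P r = 2 * u" using ev[of r] by auto
    then have "dyadic_V P (Suc r) = 2 * (2 * u\<^sup>2 - 1)"
      using assms by (simp add: dyadic_V_Suc power2_eq_square)
    then show ?thesis by simp
  qed
  define u where "u = dyadic_V P (Suc r) div 2"
  have "dyadic_V P (Suc r) = 2 * u" using ev[of "Suc r"] by (simp add: u_def)
  then have "dyadic_V P (Suc (Suc r)) = 2 * (2 * u\<^sup>2 - 1)"
    using assms by (simp add: dyadic_V_Suc[of P "Suc r"] power2_eq_square)
  moreover have "u\<^sup>2 mod 8 = 1" using odd[of r] by (simp add: u_def square_mod_8)
  ultimately show "(dyadic_V P (Suc (Suc r)) div 2) mod 8 = 1" by simp presburger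
qed

text \<open>\<open>2 u \<equiv> -1\<close> modulo \<open>t\<close>, where \<open>2\<close> is a quadratic residue of \<open>t\<close> since \<open>t \<equiv> \<plusminus>1\<close> modulo \<open>8\<close>.\<close>
lemma Jacobi_half_dyadic_V:
  assumes "P \<ge> 3" "P mod 8 = 0"
  defines "u \<equiv> (\<lambda>r. dyadic_V P r div 2)"
  shows "Jacobi (- (P + 1)) (u 1) = -1"
    and "Jacobi (- (P - 1)) (u (Suc r)) = -1"
proof -
  have u0: "u r > 0" for r using dyadic_V_ge[OF assms(1), of r] by (simp add: u_def)
  have u2: "2 * u r = dyadic_V P r" for r
    using dyadic_V_half(1)[OF assms(1,2), of r] by (simp add: u_def)
  have u1: "u 1 mod 8 = 7" using dyadic_V_half(2)[OF assms(1,2)] by (simp add: u_def)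
  have ur: "u (Suc (Suc r)) mod 8 = 1" for r
    using dyadic_V_half(3)[OF assms(1,2)] by (simp add: u_def)
  have u1': "odd (u 1)" "u 1 mod 4 = 3" using u1 by presburger+
  have P: "(P + 1) mod 8 = 1" "(P - 1) mod 8 = 7" using assms(2) by presburger+
  have P': "P + 1 > 0" "odd (P + 1)" "(P + 1) mod 4 = 1"
    "P - 1 > 0" "odd (P - 1)" "(P - 1) mod 4 = 3"
    using assms(1) P by (linarith, presburger, presburger, linarith, presburger, presburger)
  have a: "Jacobi (u (Suc r)) (P + 1) = 1" for r
  proof -
    have "Jacobi (2 * u (Suc r)) (P + 1) = Jacobi (-1) (P + 1)"
      unfolding u2 by (rule Jacobi_cong) (rule dyadic_V_cong_minus_one(1)[OF assms(1)])
    then show ?thesis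
      using Jacobi_mult_left[OF P'(2)] Jacobi_two[OF P'(1,2)] Jacobi_minus_one[OF P'(1,2)] P P'
      by simp
  qed
  have b: "Jacobi (u (Suc r)) (P - 1) = -1" for r
  proof -
    have "Jacobi (2 * u (Suc r)) (P - 1) = Jacobi (-1) (P - 1)"
      unfolding u2 by (rule Jacobi_cong) (rule dyadic_V_cong_minus_one(2)[OF assms(1)])
    then show ?thesis
      using Jacobi_mult_left[OF P'(5)] Jacobi_two[OF P'(4,5)] Jacobi_minus_one[OF P'(4,5)] P P'
      by simp
  qed
  show "Jacobi (- (P + 1)) (u 1) = -1"
    using Jacobi_uminus[OF u0 u1'(1), of "P + 1"] u1'(2) a[of 0] Jacobi_reciprocity[OF P'(1,2) u0 u1'(1)] P'
    by simp
  show "Jacobi (- (P - 1)) (u (Suc r)) = -1"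
  proof (cases r)
    case 0
    then show ?thesis
      using Jacobi_uminus[OF u0 u1'(1), of "P - 1"] u1'(2) b[of 0] Jacobi_reciprocity[OF P'(4,5) u0 u1'(1)] P'
      by simp
  next
    case (Suc s)
    have "odd (u (Suc r))" "u (Suc r) mod 4 = 1" using ur[of s] Suc by simp_all presburger+
    then show ?thesis
      using Jacobi_uminus[OF u0, of "Suc r" "P - 1"] b[of r] Jacobi_reciprocity[OF P'(4,5) u0, of "Suc r"] P'
      by simp
  qed
qed

section \<open>Squares of the form \<open>lucas_V P n + 1\<close>\<close>

lemma lucas_V_mod:
  assumes "odd n"
  shows "P mod 8 = 4 \<Longrightarrow> lucas_V P n mod 8 = 4"
    and "P mod 4 = 2 \<Longrightarrow> lucas_V P n mod 4 = 2"
proof -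
  obtain q where n: "n = 2 * q + 1" using assms by (auto elim: oddE)
  show "lucas_V P n mod 8 = 4" if P: "P mod 8 = 4"
  proof -
    have "lucas_V P (2 * q) mod 2 = 0 \<and> lucas_V P (2 * q + 1) mod 8 = 4"
    proof (induction q)
      case (Suc q)
      obtain a b c where abc: "lucas_V P (2 * q) = 2 * a" "lucas_V P (2 * q + 1) = 8 * b + 4"
        "P = 8 * c + 4"
        using Suc P by (metis mod_0_imp_dvd dvdE mult_div_mod_eq)
      have 1: "lucas_V P (2 * q + 2) = P * (8 * b + 4) - 2 * a" using abc by simp
      have "lucas_V P (2 * Suc q) = 2 * (4 * P * b + 2 * P - a)" using 1 by (simp add: algebra_simps)
      moreover have "lucas_V P (2 * Suc q + 1) = P * (P * (8 * b + 4) - 2 * a) - (8 * b + 4)"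
        using 1 abc by simp
      then obtain X where "lucas_V P (2 * Suc q + 1) = 8 * X + 4"
        by (intro that[of "(8*c+4) * (2*c+1) * (4*b+2) - 2*a*c - a - b - 1"])
          (simp add: abc(3) algebra_simps)
      then have "lucas_V P (2 * Suc q + 1) mod 8 = 4" by presburger
      ultimately show ?case by simp
    qed (use P in auto)
    then show ?thesis by (simp add: n)
  qed
  show "lucas_V P n mod 4 = 2" if P: "P mod 4 = 2"
  proof -
    have "lucas_V P (2 * q) mod 4 = 2 \<and> lucas_V P (2 * q + 1) mod 4 = 2"
    proof (induction q)
      case (Suc q)
      obtain a b c where abc: "lucas_V P (2 * q) = 4 * a + 2" "lucas_V P (2 * q + 1) = 4 * b + 2"
        "P = 4 * c + 2"
        using Suc P by (metis mult_div_mod_eq)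
      have 1: "lucas_V P (2 * q + 2) = 4 * (P * b + 2 * c - a) + 2"
        using abc by (simp add: algebra_simps)
      then have "lucas_V P (2 * q + 3) = P * (4 * (P * b + 2 * c - a) + 2) - (4 * b + 2)"
        using abc by (simp add: numeral_3_eq_3)
      then have "lucas_V P (2 * q + 3) = 4 * (P * (P * b + 2 * c - a) + 2 * c - b) + 2"
        by (simp add: abc(3) algebra_simps)
      then obtain X where "lucas_V P (2 * q + 3) = 4 * X + 2" by blast
      then have "lucas_V P (2 * q + 3) mod 4 = 2" by presburger
      moreover have "lucas_V P (2 * q + 2) mod 4 = 2" using 1 by presburger
      ultimately show ?case by (simp add: numeral_3_eq_3)
    qed (use P in auto)
    then show ?thesis by (simp add: n)
  qed
qed

lemma square_mod_4: "(z::int)\<^sup>2 mod 4 = 0 \<or> z\<^sup>2 mod 4 = 1"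
proof -
  have "z mod 4 = 0 \<or> z mod 4 = 1 \<or> z mod 4 = 2 \<or> z mod 4 = 3" by presburger
  then show ?thesis by (auto simp: power2_eq_square mod_mult_eq[of z 4 z, symmetric])
qed

lemma square_mod_8_ne_5: "(z::int)\<^sup>2 mod 8 \<noteq> 5"
  using square_mod_8[of z] by (cases "odd z") (auto simp: power2_eq_square elim!: evenE, presburger)

text \<open>For odd P or 8 dividing P, \<open>lucas_V P n + 1\<close> is -(P - 1) modulo a dyadic
  modulus, with Jacobi symbol -1. The other P make it 5 modulo 8 or 3 modulo 4.\<close>

lemma lucas_V_plus_one_square:
  assumes P: "P \<ge> 3" and n: "odd n" and z: "lucas_V P n + 1 = z\<^sup>2"
  shows "n = 1"
proof (rule ccontr)
  assume "n \<noteq> 1"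
  then obtain r where r: "[lucas_V P n = - P] (mod dyadic_V P (Suc r))"
    using lucas_V_cong_odd_index[OF P n] by blast
  have r': "[lucas_V P n + 1 = - (P - 1)] (mod dyadic_V P (Suc r))"
    using cong_add[OF r cong_refl[of 1]] by simp
  consider "odd P" | "P mod 8 = 0" | "P mod 8 = 4" | "P mod 4 = 2" by atomize_elim presburger
  then show False
  proof cases
    case 1
    show False
      using square_not_cong[OF z r' dvd_refl] dyadic_V_odd(1)[OF P 1] Jacobi_dyadic_V_odd(3)[OF P 1]
      by blast
  next
    case 2
    have "(dyadic_V P (Suc r) div 2) mod 8 = 7 \<or> (dyadic_V P (Suc r) div 2) mod 8 = 1"
      using dyadic_V_half(2,3)[OF P 2] by (cases r) simp_all
    then have "odd (dyadic_V P (Suc r) div 2)" by presburger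
    moreover have "(dyadic_V P (Suc r) div 2) dvd dyadic_V P (Suc r)"
      using dyadic_V_half(1)[OF P 2, of "Suc r"] by (metis dvd_div_mult_self dvd_triv_left)
    ultimately show False
      using square_not_cong[OF z r'] Jacobi_half_dyadic_V(2)[OF P 2] by blast
  next
    case 3
    then have "lucas_V P n mod 8 = 4" using lucas_V_mod(1)[OF n] by blast
    then have "z\<^sup>2 mod 8 = 5" unfolding z[symmetric] by presburger
    then show False using square_mod_8_ne_5 by blast
  next
    case 4
    then have "lucas_V P n mod 4 = 2" using lucas_V_mod(2)[OF n] by blast
    then have "z\<^sup>2 mod 4 = 3" unfolding z[symmetric] by presburger
    then show False using square_mod_4[of z] by presburger
  qed
qed

section \<open>Squares among Lehmer numbers\<close>

lemma lehmer_mod_step: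
  "lehmer P (Suc (Suc n)) mod m = ((P mod m) * (lehmer P (Suc n) mod m) - lehmer P n mod m) mod m"
  by (metis lehmer.simps(3) mod_diff_eq mod_mult_eq mod_mod_trivial)

text \<open>The sequence has period 6 modulo 4, hence three pairs with even first index. Their
  second entries 2 and 3 are not squares modulo 4.\<close>

lemma lehmer_mod_4_one:
  assumes "P mod 4 = 1"
  shows "(lehmer P (2 * q) mod 4, lehmer P (Suc (2 * q)) mod 4) \<in> {(1, 2), (1, 3), (2, 3)}"
proof (induction q)
  case 0
  show ?case using assms by simp presburger
next
  case (Suc q)
  have e: "lehmer P (2 * Suc q) = lehmer P (Suc (Suc (2 * q)))"
    "lehmer P (Suc (2 * Suc q)) = lehmer P (Suc (Suc (Suc (2 * q))))" by simp_all
  show ?case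
    using Suc unfolding e by (auto simp: lehmer_mod_step assms simp del: lehmer.simps)
qed

lemma lehmer_mod_4_two:
  assumes "P mod 4 = 2"
  shows "lehmer P (2 * q) mod 4 = 1 \<and> lehmer P (Suc (2 * q)) mod 4 = 3"
proof (induction q)
  case 0
  show ?case using assms by simp presburger
next
  case (Suc q)
  have e: "lehmer P (2 * Suc q) = lehmer P (Suc (Suc (2 * q)))"
    "lehmer P (Suc (2 * Suc q)) = lehmer P (Suc (Suc (Suc (2 * q))))" by simp_all
  show ?case
    using Suc unfolding e by (auto simp: lehmer_mod_step assms simp del: lehmer.simps)
qed

lemma lehmer_mod_4_zero:
  assumes "P mod 4 = 0"
  shows "lehmer P (Suc (4 * q)) mod 4 = 1 \<and> lehmer P (Suc (Suc (Suc (4 * q)))) mod 4 = 3"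
proof (induction q)
  case 0
  have "lehmer P (Suc 0) mod 4 = 1" using assms by simp presburger
  then show ?case using lehmer_mod_step[of P "Suc 0" 4] by (simp add: assms del: lehmer.simps(3))
next
  case (Suc q)
  have e: "Suc (4 * Suc q) = Suc (Suc (Suc (Suc (Suc (4 * q)))))" by simp
  show ?case
    using Suc unfolding e by (auto simp: lehmer_mod_step assms simp del: lehmer.simps)
qed

lemma lehmer_mod_8_four:
  assumes "P mod 8 = 4"
  shows "lehmer P (4 * q) mod 8 = 1 \<and> lehmer P (Suc (4 * q)) mod 8 = 5"
proof (induction q)
  case 0
  show ?case using assms by simp presburger
next
  case (Suc q)
  have e: "4 * Suc q = Suc (Suc (Suc (Suc (4 * q))))" by simp
  show ?case
    using Suc unfolding e by (auto simp: lehmer_mod_step assms simp del: lehmer.simps)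
qed

lemma lehmer_cong_dyadic:
  assumes "P \<ge> 3" "odd g"
  shows "[lehmer P (m + 2 * 2 ^ r * g) = - lehmer P m] (mod dyadic_V P r)"
  using lehmer_cong_step[OF assms(1), of m "2 ^ r" g] assms(2) by (simp add: dyadic_V_def)

lemma lehmer_2: "lehmer P 2 = P\<^sup>2 + P - 1"
  by (simp add: numeral_2_eq_2 power2_eq_square algebra_simps)

text \<open>P^2 + P - 1 lies strictly between the consecutive squares P^2 and (P + 1)^2.\<close>

lemma lehmer_2_not_square:
  assumes "P \<ge> 3"
  shows "lehmer P 2 \<noteq> z\<^sup>2"
proof
  assume "lehmer P 2 = z\<^sup>2"
  then have "\<bar>z\<bar>\<^sup>2 = P\<^sup>2 + P - 1" by (simp add: lehmer_2)
  then have "P\<^sup>2 < \<bar>z\<bar>\<^sup>2" "\<bar>z\<bar>\<^sup>2 < (P + 1)\<^sup>2" using assms by (simp_all add: power2_eq_square algebra_simps)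
  then have "P < \<bar>z\<bar>" "\<bar>z\<bar> < P + 1"
    using assms power2_less_imp_less[of P "\<bar>z\<bar>"] power2_less_imp_less[of "\<bar>z\<bar>" "P + 1"] by linarith+
  then show False by simp
qed

section \<open>Square Lehmer numbers for odd P\<close>

text \<open>Modulo P^2 + P - 1 the powers of t^2 behave like fifth roots of unity, so
  \<open>dyadic_V\<close> alternates between P and -P - 1, the roots of X^2 + X - 1. Both have
  symbol 1; after reciprocity the minus sign contributes -1.\<close>

lemma Jacobi_lehmer_2_dyadic_V:
  assumes P: "P \<ge> 3" "P mod 4 = 1"
  shows "Jacobi (- lehmer P 2) (dyadic_V P (Suc r)) = -1"
proof -
  define v where "v = dyadic_V P (Suc r)"
  define t where "t = P\<^sup>2 + P - 1"
  have oddP: "odd P" using P(2) by presburger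
  have v: "v > 0" "v mod 8 = 7"
    using dyadic_V_ge[OF P(1), of "Suc r"] dyadic_V_odd[OF P(1) oddP, of r] by (auto simp: v_def)
  then have v': "odd v" "v mod 4 = 3" by presburger+
  have P2: "P\<^sup>2 mod 8 = 1" using oddP by (rule square_mod_8)
  have t: "t > 0" "odd t" "t mod 4 = 1"
  proof -
    have "P\<^sup>2 > 0" using P(1) by simp
    then show "t > 0" using P(1) unfolding t_def by linarith
    show "odd t" "t mod 4 = 1" using P2 P(2) unfolding t_def by presburger+
  qed
  have JP: "Jacobi P t = 1"
  proof -
    have "Jacobi P t = Jacobi t P"
      using Jacobi_reciprocity[of P t] P oddP t by simp
    also have "\<dots> = Jacobi (-1) P"
      by (rule Jacobi_cong) (simp add: t_def cong_iff_dvd_diff power2_eq_square)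
    also have "\<dots> = 1" using Jacobi_minus_one[of P] P oddP by simp
    finally show ?thesis .
  qed
  have JP1: "Jacobi (- P - 1) t = 1"
  proof -
    define h where "h = (P + 1) div 2"
    have h: "P + 1 = 2 * h" "h > 0" "odd h" using P by (auto simp: h_def) presburger+
    have "Jacobi (- P - 1) t = Jacobi (- (2 * h)) t" unfolding h(1)[symmetric] by simp
    also have "\<dots> = Jacobi (2 * h) t" using Jacobi_uminus[OF t(1,2)] t(3) by simp
    also have "\<dots> = Jacobi 2 t * Jacobi h t" by (rule Jacobi_mult_left[OF t(2)])
    also have "Jacobi h t = Jacobi t h" using Jacobi_reciprocity[OF h(2,3) t(1,2)] t(3) by simp
    also have "\<dots> = Jacobi (-1) h"
    proof (rule Jacobi_cong)
      have "t - (-1) = P * (P + 1)" by (simp add: t_def power2_eq_square algebra_simps)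
      then have "t - (-1) = h * (2 * P)" using h(1) by simp
      then show "[t = -1] (mod h)" by (simp add: cong_iff_dvd_diff)
    qed
    finally have J: "Jacobi (- P - 1) t = Jacobi 2 t * Jacobi (-1) h" .
    \<comment> \<open>The symbols of 2 modulo t and of -1 modulo h change sign together.\<close>
    have "P mod 8 = 1 \<or> P mod 8 = 5" using P(2) by presburger
    then show ?thesis
    proof
      assume "P mod 8 = 1"
      then have "t mod 8 = 1" "h mod 4 = 1" using P2 h(1) unfolding t_def by presburger+
      then show ?thesis using J Jacobi_two[OF t(1,2)] Jacobi_minus_one[OF h(2,3)] by simp
    next
      assume "P mod 8 = 5"
      then have "t mod 8 = 5" "h mod 4 = 3" using P2 h(1) unfolding t_def by presburger+
      then show ?thesis using J Jacobi_two[OF t(1,2)] Jacobi_minus_one[OF h(2,3)] by simp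
    qed
  qed
  have "[v = P] (mod t) \<or> [v = - P - 1] (mod t)"
    unfolding v_def
  proof (induction r)
    case 0
    have "P\<^sup>2 - 2 - (- P - 1) = t" by (simp add: t_def)
    then show ?case using dyadic_V_Suc[OF P(1), of 0] by (simp add: cong_iff_dvd_diff)
  next
    case (Suc r)
    then show ?case
    proof
      assume "[dyadic_V P (Suc r) = P] (mod t)"
      then have "[dyadic_V P (Suc (Suc r)) = P\<^sup>2 - 2] (mod t)"
        unfolding dyadic_V_Suc[OF P(1), of "Suc r"] by (intro cong_diff cong_pow) auto
      moreover have "P\<^sup>2 - 2 - (- P - 1) = t" by (simp add: t_def)
      then have "[P\<^sup>2 - 2 = - P - 1] (mod t)" by (simp add: cong_iff_dvd_diff)
      ultimately show ?thesis using cong_trans by blast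
    next
      assume "[dyadic_V P (Suc r) = - P - 1] (mod t)"
      then have "[dyadic_V P (Suc (Suc r)) = (- P - 1)\<^sup>2 - 2] (mod t)"
        unfolding dyadic_V_Suc[OF P(1), of "Suc r"] by (intro cong_diff cong_pow) auto
      moreover have "(- P - 1)\<^sup>2 - 2 - P = t" by (simp add: t_def power2_eq_square algebra_simps)
      then have "[(- P - 1)\<^sup>2 - 2 = P] (mod t)" by (simp add: cong_iff_dvd_diff)
      ultimately show ?thesis using cong_trans by blast
    qed
  qed
  then have "Jacobi v t = 1" using JP JP1 Jacobi_cong by metis
  then have "Jacobi t v = 1" using Jacobi_reciprocity[OF t(1,2) v(1) v'(1)] t(3) by simp
  then show ?thesis
    using Jacobi_uminus[OF v(1) v'(1), of t] v'(2) unfolding lehmer_2 t_def[symmetric] v_def[symmetric] by simp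
qed

lemma even_decompose_twice:
  fixes n :: nat
  assumes "n > 0" "even n"
  obtains r g where "n = 2 * 2 ^ r * g" "odd g"
proof -
  have "n div 2 > 0" using assms by presburger
  then obtain r g where "n div 2 = 2 ^ r * g" "odd g" by (rule even_decompose)
  moreover have "n = 2 * (n div 2)" using assms by presburger
  ultimately show ?thesis using that[of r g] by simp
qed

text \<open>Writing i or i - 1 as 2 * 2^r * g with g odd gives the residue -1 or -(P + 1) modulo
  \<open>dyadic_V P r\<close>. For P = 1 modulo 4, odd i fail modulo 4, and even i with r = 0 are
  compared with index 2.\<close>

lemma lehmer_square_odd:
  assumes P: "P \<ge> 3" "odd P" and z: "lehmer P i = z\<^sup>2"
  shows "i \<le> 1"
proof (rule ccontr)
  assume i: "\<not> i \<le> 1"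
  have J0: "Jacobi (-1) P = -1" if "P mod 4 = 3"
    using Jacobi_minus_one[of P] P that by simp
  have P4: "P mod 4 = 1 \<or> P mod 4 = 3" using P(2) by presburger
  show False
  proof (cases "even i")
    case True
    have "i > 0" using i by simp
    then obtain r g where rg: "i = 2 * 2 ^ r * g" "odd g" using even_decompose_twice True by blast
    have c: "[lehmer P i = -1] (mod dyadic_V P r)"
      using lehmer_cong_dyadic[OF P(1) rg(2), of 0 r] rg(1) by simp
    show False
    proof (cases r)
      case (Suc s)
      show False
        using square_not_cong[OF z c dvd_refl] dyadic_V_odd(1)[OF P, of r]
          Jacobi_dyadic_V_odd(1)[OF P, of s] Suc by simp
    next
      case 0
      show False
      proof (cases "P mod 4 = 3")
        case True
        show False using square_not_cong[OF z c dvd_refl] 0 P J0[OF True] by simp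
      next
        case False
        then have P1: "P mod 4 = 1" using P4 by blast
        \<comment> \<open>Since -1 has symbol 1 modulo P, the modulus P is useless here; i - 2 is a
          multiple of 4 and allows a higher dyadic modulus.\<close>
        have "i \<noteq> 2" using lehmer_2_not_square[OF P(1)] z by metis
        have "i mod 4 = 2" using rg 0 by simp presburger
        then have "(i - 2) div 2 > 0" "even ((i - 2) div 2)" using \<open>i \<noteq> 2\<close> i by presburger+
        then obtain s h where sh: "(i - 2) div 2 = 2 * 2 ^ s * h" "odd h"
          using even_decompose_twice by blast
        moreover have "i = 2 + 2 * ((i - 2) div 2)" using \<open>i mod 4 = 2\<close> i by presburger
        ultimately have "i = 2 + 2 * 2 ^ Suc s * h" by simp
        then have "[lehmer P i = - lehmer P 2] (mod dyadic_V P (Suc s))"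
          using lehmer_cong_dyadic[OF P(1) sh(2), of 2 "Suc s"] by simp
        then show False
          using square_not_cong[OF z _ dvd_refl] dyadic_V_odd(1)[OF P, of "Suc s"]
            Jacobi_lehmer_2_dyadic_V[OF P(1) P1, of s] by blast
      qed
    qed
  next
    case False
    then have i2: "i = Suc (2 * (i div 2))" by presburger
    show False
    proof (cases "P mod 4 = 1")
      case True
      have "lehmer P i mod 4 = 2 \<or> lehmer P i mod 4 = 3"
        using lehmer_mod_4_one[OF True, of "i div 2"] i2 by auto
      then show False using square_mod_4[of z] z by auto
    next
      case nP: False
      then have P3: "P mod 4 = 3" using P4 by blast
      have "i - 1 > 0" "even (i - 1)" using i False by auto
      then obtain r g where rg: "i - 1 = 2 * 2 ^ r * g" "odd g" using even_decompose_twice by blast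
      have "i = 1 + 2 * 2 ^ r * g" using rg(1) i by simp
      then have c: "[lehmer P i = - (P + 1)] (mod dyadic_V P r)"
        using lehmer_cong_dyadic[OF P(1) rg(2), of 1 r] by simp
      show False
      proof (cases r)
        case (Suc s)
        show False
          using square_not_cong[OF z c dvd_refl] dyadic_V_odd(1)[OF P, of r]
            Jacobi_dyadic_V_odd(2)[OF P, of s] Suc by blast
      next
        case 0
        have "Jacobi (- (P + 1)) P = Jacobi (-1) P"
          by (rule Jacobi_cong) (simp add: cong_iff_dvd_diff)
        then show False using square_not_cong[OF z c dvd_refl] 0 P J0[OF P3] by simp
      qed
    qed
  qed
qed

section \<open>Square Lehmer numbers for even P\<close>

text \<open>The number 2 is a fixed point of X^2 - 2, so each congruence persists once it
  holds.\<close>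

lemma dyadic_V_cong_two:
  assumes "P \<ge> 3"
  shows "[dyadic_V P (i + 2 + k) = 2] (mod (dyadic_V P i)\<^sup>2)"
    and "[dyadic_V P (Suc k) = 2] (mod (P + 2))"
proof -
  show "[dyadic_V P (i + 2 + k) = 2] (mod (dyadic_V P i)\<^sup>2)"
  proof (induction k)
    case 0
    define d where "d = (dyadic_V P i)\<^sup>2"
    have "dyadic_V P (i + 2) = (d - 2)\<^sup>2 - 2"
      using assms by (simp add: dyadic_V_Suc d_def)
    then have "dyadic_V P (i + 2) - 2 = d * (d - 4)" by (simp add: power2_eq_square algebra_simps)
    then show ?case by (simp add: d_def cong_iff_dvd_diff)
  next
    case (Suc k)
    then have "[(dyadic_V P (i + 2 + k))\<^sup>2 - 2 = 2\<^sup>2 - 2] (mod (dyadic_V P i)\<^sup>2)"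
      by (intro cong_diff cong_pow) auto
    then show ?case using dyadic_V_Suc[OF assms, of "i + 2 + k"] by simp
  qed
  show "[dyadic_V P (Suc k) = 2] (mod (P + 2))"
  proof (induction k)
    case 0
    have "P\<^sup>2 - 2 - 2 = (P + 2) * (P - 2)" by (simp add: power2_eq_square algebra_simps)
    then show ?case using dyadic_V_Suc[OF assms, of 0] by (simp add: cong_iff_dvd_diff)
  next
    case (Suc k)
    then have "[(dyadic_V P (Suc k))\<^sup>2 - 2 = 2\<^sup>2 - 2] (mod (P + 2))"
      by (intro cong_diff cong_pow) auto
    then show ?case using dyadic_V_Suc[OF assms, of "Suc k"] by simp
  qed
qed

text \<open>With m = 2^(s+3) and M half of \<open>lucas_V P m\<close>,
  \<open>lehmer_via_lucas\<close> reduces twice the Lehmer number modulo M to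
  \<open>lucas_U P m * (P + 2) * (P - 1)\<close>. All symbols modulo M are 1 except that of P -
  1.\<close>

lemma Jacobi_lehmer_half_dyadic_V:
  assumes P: "P \<ge> 3" "P mod 8 = 0"
  shows "Jacobi (lehmer P (2 ^ (s + 3) + 1)) (dyadic_V P (s + 3) div 2) = -1"
proof -
  define M where "M = dyadic_V P (s + 3) div 2"
  have M2: "dyadic_V P (s + 3) = 2 * M" using dyadic_V_half(1)[OF P, of "s + 3"] by (simp add: M_def)
  have M: "M > 0" "M mod 8 = 1"
    using dyadic_V_ge[OF P(1), of "s + 3"] dyadic_V_half(3)[OF P, of "s + 1"]
    by (simp_all add: M_def numeral_3_eq_3)
  then have M': "odd M" "M mod 4 = 1" by presburger+
  have J2: "Jacobi 2 M = 1" using Jacobi_two[OF M(1) M'(1)] M(2) by simp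
  \<comment> \<open>For i = s + 2, M is -1 modulo half of \<open>dyadic_V P i\<close>. For smaller i
    it is 1 modulo \<open>dyadic_V P i\<close>, since 2 M is 2 modulo the square of that even
    number.\<close>
  have Jd: "Jacobi (dyadic_V P i) M = 1" if "i < s + 3" for i
  proof (cases "i = s + 2")
    case True
    define u where "u = dyadic_V P i div 2"
    have u2: "dyadic_V P i = 2 * u" using dyadic_V_half(1)[OF P, of i] by (simp add: u_def)
    have u: "u > 0" "u mod 8 = 1"
      using dyadic_V_ge[OF P(1), of i] dyadic_V_half(3)[OF P, of s] True by (simp_all add: u_def)
    then have u': "odd u" "u mod 4 = 1" by presburger+
    have "2 * M = 2 * (2 * u\<^sup>2 - 1)"
      using dyadic_V_Suc[OF P(1), of i] True u2 M2 by (simp add: numeral_3_eq_3 power2_eq_square)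
    then have "M - (-1) = u * (2 * u)" by (simp add: power2_eq_square)
    then have "Jacobi M u = Jacobi (-1) u" by (intro Jacobi_cong) (simp add: cong_iff_dvd_diff)
    then have "Jacobi u M = 1"
      using Jacobi_reciprocity[OF u(1) u'(1) M(1) M'(1)] u'(2) Jacobi_minus_one[OF u(1) u'(1)] by simp
    then show ?thesis using Jacobi_mult_left[OF M'(1), of 2 u] J2 u2 by simp
  next
    case False
    then have "i \<le> s + 1" using that by linarith
    then obtain k where "s + 1 = i + k" using le_Suc_ex by blast
    then have k: "s + 3 = i + 2 + k" by simp
    obtain u where u: "dyadic_V P i = 2 * u" using dyadic_V_half(1)[OF P, of i] by auto
    have "(2 * u)\<^sup>2 dvd 2 * M - 2"
      using dyadic_V_cong_two(1)[OF P(1), of i k] unfolding k[symmetric] M2 u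
      by (simp add: cong_iff_dvd_diff)
    then obtain c where "2 * M - 2 = (2 * u)\<^sup>2 * c" by auto
    then have "M - 1 = (2 * u) * (u * c)" by (simp add: power2_eq_square)
    then have "[M = 1] (mod dyadic_V P i)" unfolding u by (simp add: cong_iff_dvd_diff)
    then show ?thesis using Jacobi_eq_one_of_cong_one[OF M] dyadic_V_ge[OF P(1), of i] by simp
  qed
  \<comment> \<open>By repeated doubling, \<open>lucas_U\<close> at 2^r is the product of the
    \<open>dyadic_V P i\<close> with i < r.\<close>
  have JU: "Jacobi (lucas_U P (2 ^ r)) M = 1" if "r \<le> s + 3" for r
    using that
  proof (induction r)
    case (Suc r)
    have "lucas_U P (2 ^ Suc r) = lucas_U P (2 ^ r) * dyadic_V P r"
      using lucas_U_double[OF P(1), of "2 ^ r"] by (simp add: dyadic_V_def)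
    then show ?case using Suc Jd[of r] by (simp add: Jacobi_mult_left[OF M'(1)])
  qed (use M M' in simp)
  have JP2: "Jacobi (P + 2) M = 1"
  proof -
    obtain h where h: "P = 8 * h" using P(2) by auto
    have "2 * (4 * h + 1) dvd 2 * (M - 1)"
      using dyadic_V_cong_two(2)[OF P(1), of "s + 2"] M2 h by (simp add: cong_iff_dvd_diff numeral_3_eq_3)
    then have "[M = 1] (mod (4 * h + 1))"
      unfolding cong_iff_dvd_diff by (simp only: dvd_times_left_cancel_iff[of 2, simplified] simp_thms)
    then have "Jacobi (4 * h + 1) M = 1" using Jacobi_eq_one_of_cong_one[OF M] P(1) h by simp
    moreover have "P + 2 = 2 * (4 * h + 1)" using h by simp
    ultimately show ?thesis using Jacobi_mult_left[OF M'(1), of 2 "4 * h + 1"] J2 by simp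
  qed
  have JP1: "Jacobi (P - 1) M = -1"
    using Jacobi_half_dyadic_V(2)[OF P, of "s + 2"] Jacobi_uminus[OF M(1) M'(1), of "P - 1"] M'(2)
    by (simp add: M_def numeral_3_eq_3)
  have "[2 * lehmer P (2 ^ (s + 3) + 1) = lucas_U P (2 ^ (s + 3)) * (P + 2) * (P - 1)] (mod M)"
    using lehmer_via_lucas[OF P(1), of "2 ^ (s + 3)"] M2
    by (simp add: dyadic_V_def[symmetric] cong_iff_dvd_diff)
  then have "Jacobi (2 * lehmer P (2 ^ (s + 3) + 1)) M
      = Jacobi (lucas_U P (2 ^ (s + 3)) * (P + 2) * (P - 1)) M" by (rule Jacobi_cong)
  then show ?thesis
    using J2 JU[of "s + 3"] JP2 JP1 by (simp add: Jacobi_mult_left[OF M'(1)] M_def[symmetric])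
qed

text \<open>Even i belong to the Pade argument. Odd i fail modulo 4 or 8, unless 8 divides P and i
  is 1 modulo 4; then halved dyadic moduli are used.\<close>

lemma lehmer_square_even:
  assumes P: "P \<ge> 3" "even P" and z: "lehmer P i = z\<^sup>2"
  shows "i \<le> 1"
proof (cases "even i")
  case True
  then obtain j where "i = 2 * j" by auto
  moreover have "P \<ge> 4" using P by presburger
  ultimately show ?thesis using lehmer_even_square[of P j z] P(2) z by simp
next
  case False
  show ?thesis
  proof (rule ccontr)
    assume i: "\<not> i \<le> 1"
    have i2: "i = Suc (2 * (i div 2))" using False by presburger
    have "P mod 4 = 2 \<or> P mod 8 = 4 \<or> P mod 8 = 0" using P(2) by presburger
    moreover have False if "P mod 4 = 2"
      using lehmer_mod_4_two[OF that, of "i div 2"] i2 z square_mod_4[of z] by simp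
    moreover have False if P4: "P mod 4 = 0" and i4: "i mod 4 = 3"
    proof -
      have "i = Suc (Suc (Suc (4 * (i div 4))))" using i4 by presburger
      then show False using lehmer_mod_4_zero[OF P4, of "i div 4"] z square_mod_4[of z] by simp
    qed
    moreover have False if P4: "P mod 8 = 4" and i4: "i mod 4 = 1"
    proof -
      have "i = Suc (4 * (i div 4))" using i4 by presburger
      then show False using lehmer_mod_8_four[OF P4, of "i div 4"] z square_mod_8_ne_5[of z] by simp
    qed
    moreover have False if P8: "P mod 8 = 0" and i4: "i mod 4 = 1"
    proof -
      have "(i - 1) div 2 > 0" "even ((i - 1) div 2)" using i i4 by presburger+
      then obtain r g where rg: "(i - 1) div 2 = 2 * 2 ^ r * g" "odd g"
        using even_decompose_twice by blast
      have "i = 1 + 2 * ((i - 1) div 2)" using i4 by presburger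
      then have i_eq: "i = 1 + 2 * 2 ^ Suc r * g" using rg(1) by simp
      show False
      proof (cases r)
        case 0
        have "[lehmer P i = - (P + 1)] (mod dyadic_V P 1)"
          using lehmer_cong_dyadic[OF P(1) rg(2), of 1 1] i_eq 0 by simp
        moreover have "(dyadic_V P 1 div 2) dvd dyadic_V P 1"
          using dyadic_V_half(1)[OF P(1) P8, of 1] by (metis dvd_div_mult_self dvd_triv_left)
        moreover have "odd (dyadic_V P 1 div 2)"
          using dyadic_V_half(2)[OF P(1) P8] by presburger
        ultimately show False
          using square_not_cong[OF z] Jacobi_half_dyadic_V(1)[OF P(1) P8] by blast
      next
        case (Suc s)
        define M where "M = dyadic_V P (s + 3) div 2"
        have M2: "dyadic_V P (s + 3) = 2 * M"
          using dyadic_V_half(1)[OF P(1) P8, of "s + 3"] by (simp add: M_def)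
        have M: "M > 0" "M mod 8 = 1"
          using dyadic_V_ge[OF P(1), of "s + 3"] dyadic_V_half(3)[OF P(1) P8, of "s + 1"]
          by (simp_all add: M_def numeral_3_eq_3)
        then have M': "odd M" "M mod 4 = 1" by presburger+
        obtain h where h: "g = 2 * h + 1" using rg(2) by (auto elim: oddE)
        \<comment> \<open>Modulo half of \<open>dyadic_V P (s + 2)\<close> the residue -(P + 1) has
          symbol 1. One level higher the base index becomes 2^(s+3) + 1, and the sign (-1)^h is
          harmless as M is 1 modulo 4.\<close>
        have "i = (2 ^ (s + 3) + 1) + 2 * 2 ^ (s + 3) * h"
          using i_eq Suc h by (simp add: power_add algebra_simps)
        then have c: "[lehmer P i = (-1) ^ h * lehmer P (2 ^ (s + 3) + 1)] (mod dyadic_V P (s + 3))"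
          using lehmer_cong_step[OF P(1), of "2 ^ (s + 3) + 1" "2 ^ (s + 3)" h] by (simp add: dyadic_V_def)
        have "Jacobi ((-1) ^ h * lehmer P (2 ^ (s + 3) + 1)) M = -1"
          using Jacobi_lehmer_half_dyadic_V[OF P(1) P8, of s] Jacobi_uminus[OF M(1) M'(1)] M'(2)
          by (cases "even h") (simp_all add: M_def)
        then show False using square_not_cong[OF z c _ M'(1)] M2 by simp
      qed
    qed
    moreover have "i mod 4 = 1 \<or> i mod 4 = 3" using False by presburger
    moreover have "P mod 8 = 4 \<or> P mod 8 = 0 \<Longrightarrow> P mod 4 = 0" by presburger
    ultimately show False by metis
  qed
qed

lemma lehmer_square:
  assumes "P \<ge> 3" "lehmer P i = z\<^sup>2"
  shows "i \<le> 1"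
  using lehmer_square_odd[of P i z] lehmer_square_even[of P i z] assms by blast

section \<open>The quadratic equation\<close>

text \<open>Euclid's algorithm on 2 i + 1 and 2 j + 1, subtracting 2 (2 j + 1) or reflecting in it
  so that both stay odd. \<open>lehmer_diff_odd\<close> and \<open>lehmer_add_twice\<close> perform
  the same steps modulo \<open>lehmer P j\<close>.\<close>

lemma coprime_lehmer:
  assumes P: "P \<ge> 3"
  shows "coprime (2 * i + 1) (2 * j + 1) \<Longrightarrow> coprime (lehmer P i) (lehmer P j)"
proof (induction "i + j" arbitrary: i j rule: less_induct)
  case less
  have main: "coprime (lehmer P i) (lehmer P j)"
    if ij: "j \<le> i" "coprime (2 * i + 1) (2 * j + 1)"
      and IH: "\<And>k. k < i \<Longrightarrow> coprime (2 * k + 1) (2 * j + 1) \<Longrightarrow> coprime (lehmer P k) (lehmer P j)"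
    for i j :: nat
  proof -
    consider "j = 0" | "i = j" "j \<noteq> 0" | m where "i = m + 2 * j + 1" "j \<noteq> 0"
      | t where "i = j + t" "t \<le> j" "t \<noteq> 0"
    proof (cases "i \<ge> 2 * j + 1")
      case True
      then obtain m where "i = 2 * j + 1 + m" using le_Suc_ex by blast
      then show ?thesis using that(1) that(3)[of m] by (cases "j = 0") auto
    next
      case False
      obtain t where "i = j + t" using ij(1) le_Suc_ex by blast
      then show ?thesis using that(1,2) that(4)[of t] False by (cases "t = 0"; cases "j = 0") auto
    qed
    then show ?thesis
    proof cases
      case 1
      then show ?thesis by simp
    next
      case 2
      then show ?thesis using ij(2) by simp
    next
      case (3 m)
      have "2 * i + 1 = 2 * m + 1 + 2 * (2 * j + 1)" using 3 by simp
      then have "coprime (2 * m + 1) (2 * j + 1)"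
        using ij(2) by (metis coprime_iff_gcd_eq_1 gcd.commute gcd_add_mult add.commute)
      then have c: "coprime (lehmer P m) (lehmer P j)" using IH[of m] 3 by simp
      have "lehmer P i = lehmer P m + lucas_V P (m + j + 1) * lehmer P j"
        using lehmer_diff_odd[OF P, of m j] 3(1) by (simp add: algebra_simps)
      then show ?thesis
        using c by (metis coprime_iff_gcd_eq_1 gcd.commute gcd_add_mult add.commute)
    next
      case (4 t)
      have "(2 * (j - t) + 1) + (2 * i + 1) = 2 * (2 * j + 1)" using 4 by simp
      have "coprime (2 * (j - t) + 1) (2 * j + 1)"
      proof (rule coprimeI)
        fix c assume c: "c dvd 2 * (j - t) + 1" "c dvd 2 * j + 1"
        then have "c dvd 2 * i + 1"
          using \<open>(2 * (j - t) + 1) + (2 * i + 1) = 2 * (2 * j + 1)\<close> by (metis dvd_add_right_iff dvd_mult)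
        then show "is_unit c" using c(2) ij(2) coprime_common_divisor by blast
      qed
      then have c: "coprime (lehmer P (j - t)) (lehmer P j)" using IH[of "j - t"] 4 by simp
      have e: "lehmer P i + lehmer P (j - t) = lucas_V P t * lehmer P j"
        using lehmer_add_twice[OF P, of "j - t" t] 4 by (simp add: algebra_simps)
      show ?thesis
      proof (rule coprimeI)
        fix c assume c': "c dvd lehmer P i" "c dvd lehmer P j"
        then have "c dvd lehmer P (j - t)" using e by (metis dvd_add_right_iff dvd_mult)
        then show "is_unit c" using c'(2) c coprime_common_divisor by blast
      qed
    qed
  qed
  show ?case
  proof (cases "j \<le> i")
    case True
    show ?thesis by (rule main[OF True less.prems]) (use less.hyps in simp)
  next
    case False
    have "coprime (lehmer P j) (lehmer P i)"
    proof (rule main)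
      show "i \<le> j" using False by simp
      show "coprime (2 * j + 1) (2 * i + 1)" using less.prems by (rule coprime_imp_coprime) auto
      show "coprime (lehmer P k) (lehmer P i)" if "k < j" "coprime (2 * k + 1) (2 * i + 1)" for k
        using less.hyps[of k i] that by simp
    qed
    then show ?thesis by (simp add: coprime_commute)
  qed
qed

lemma coprime_mult_square:
  fixes u v s :: int
  assumes "coprime u v" "u > 0" "v > 0" "u * v = s\<^sup>2"
  obtains x y where "u = x\<^sup>2" "v = y\<^sup>2"
proof -
  obtain m n where mn: "u = int m" "v = int n" using assms(2,3) by (metis pos_int_cases)
  then have pos: "m > 0" "n > 0" and cop: "coprime m n" using assms by simp_all
  have "int (m * n) = int ((nat \<bar>s\<bar>)\<^sup>2)" using assms(4) mn by simp
  then have "m * n = (nat \<bar>s\<bar>)\<^sup>2" by (simp only: of_nat_eq_iff)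
  then have "is_nth_power 2 (m * n)" by (auto intro: is_nth_powerI)
  then have "is_nth_power 2 m" "is_nth_power 2 n"
    using is_nth_power_mult_coprime_natD[OF cop _ pos] by auto
  then obtain x y where "m = x\<^sup>2" "n = y\<^sup>2" by (auto elim!: is_nth_powerE)
  then show ?thesis using that[of "int x" "int y"] mn by simp
qed

lemma lehmer_mult_square:
  assumes P: "P \<ge> 3" and sq: "lehmer P i * lehmer P j = s\<^sup>2" and n: "\<And>x. P + 1 \<noteq> x\<^sup>2"
  shows "i = j"
proof -
  define d where "d = gcd (2 * i + 1) (2 * j + 1)"
  obtain i0 j0 where ij0: "2 * i + 1 = d * i0" "2 * j + 1 = d * j0" "coprime i0 j0"
    unfolding d_def using gcd_coprime_exists[of "2 * i + 1" "2 * j + 1"] by (auto simp: mult.commute)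
  have "odd d" "odd i0" "odd j0" using ij0 by (metis even_mult_iff odd_two_times_div_two_succ even_plus_one_iff dvd_triv_left)+
  then obtain e i' j' where e: "d = 2 * e + 1" "i0 = 2 * i' + 1" "j0 = 2 * j' + 1" by (auto elim!: oddE)
  have i: "i = 2 * e * i' + e + i'" "j = 2 * e * j' + e + j'"
    using ij0(1,2) unfolding e by (simp_all add: algebra_simps)
  define Q where "Q = lucas_V P d"
  have Q: "Q \<ge> 3" using lucas_V_ge[OF P, of d] \<open>odd d\<close> unfolding Q_def by (cases d) auto
  have W: "lehmer P i = lehmer P e * lehmer Q i'" "lehmer P j = lehmer P e * lehmer Q j'"
    using lehmer_compose[OF P, of e] i by (simp_all add: Q_def e(1))
  have "(lehmer P e)\<^sup>2 * (lehmer Q i' * lehmer Q j') = s\<^sup>2"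
    using sq unfolding W by (simp add: power2_eq_square algebra_simps)
  moreover from this have "lehmer P e dvd s" by (metis dvd_triv_left pow_divides_pow_iff zero_less_numeral)
  then obtain t where "s = lehmer P e * t" by auto
  ultimately have "lehmer Q i' * lehmer Q j' = t\<^sup>2"
    using lehmer_pos[OF P, of e] by (simp add: power_mult_distrib)
  moreover have "coprime (lehmer Q i') (lehmer Q j')"
    using coprime_lehmer[OF Q] ij0(3) e by simp
  ultimately obtain x y where xy: "lehmer Q i' = x\<^sup>2" "lehmer Q j' = y\<^sup>2"
    using coprime_mult_square lehmer_pos[OF Q] by metis
  then have le: "i' \<le> 1" "j' \<le> 1" using lehmer_square[OF Q] by blast+
  have "i' = j'"
  proof (rule ccontr)
    assume "i' \<noteq> j'"
    \<comment> \<open>One of i', j' is 1, and \<open>lehmer Q 1\<close> is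
      \<open>Q + 1\<close>.\<close>
    then have "\<exists>x. Q + 1 = x\<^sup>2" using le xy by (cases i'; cases j') auto
    then obtain x where x: "Q + 1 = x\<^sup>2" by blast
    then have "d = 1" using lucas_V_plus_one_square[OF P \<open>odd d\<close>] unfolding Q_def by blast
    then show False using x n by (simp add: Q_def)
  qed
  then show ?thesis using i by simp
qed

section \<open>Positive solutions of the quadratic equation\<close>

text \<open>The companion numbers (t^k + t^-k) / (t + t^-1) with k = 2 n + 1, which describe the
  first components of solutions. The division by 2 is exact by the next lemma.\<close>

fun co_lehmer :: "int \<Rightarrow> nat \<Rightarrow> int" where
  "co_lehmer P 0 = 1"
| "co_lehmer P (Suc n) = (P * co_lehmer P n + (P - 2) * lehmer P n) div 2"

text \<open>Both addition formulas are proved together: the second one at an index shows that the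
  numerator in the first is even there.\<close>

lemma lehmer_co_lehmer:
  "2 * co_lehmer P (Suc n) = P * co_lehmer P n + (P - 2) * lehmer P n \<and>
   2 * lehmer P (Suc n) = P * lehmer P n + (P + 2) * co_lehmer P n"
proof (induction n)
  case 0
  have "(P * 1 + (P - 2) * 1) = 2 * (P - 1)" by simp
  then show ?case by simp
next
  case (Suc n)
  define x y where "x = co_lehmer P n" and "y = lehmer P n"
  define x' y' where "x' = co_lehmer P (Suc n)" and "y' = lehmer P (Suc n)"
  have 1: "2 * x' = P * x + (P - 2) * y" "2 * y' = P * y + (P + 2) * x"
    using Suc by (simp_all add: x_def y_def x'_def y'_def)
  have "2 * (P * y' + (P + 2) * x') = P * (2 * y') + (P + 2) * (P * x + (P - 2) * y)"
    unfolding 1(1)[symmetric] by (simp add: algebra_simps)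
  also have "\<dots> = P * (2 * y') + (P * (P * y + (P + 2) * x) - 4 * y)" by (simp add: algebra_simps)
  also have "\<dots> = 2 * (2 * (P * y' - y))" unfolding 1(2)[symmetric] by (simp add: algebra_simps)
  finally have 2: "2 * lehmer P (Suc (Suc n)) = P * y' + (P + 2) * x'" by (simp add: y'_def y_def)
  have "P * x' + (P - 2) * y' = 2 * (lehmer P (Suc (Suc n)) - (x' + y'))"
    using 2 by (simp add: algebra_simps)
  then have "2 * co_lehmer P (Suc (Suc n)) = P * x' + (P - 2) * y'"
    by (simp add: x'_def y'_def del: lehmer.simps)
  then show ?case using 2 by (simp add: x'_def y'_def del: co_lehmer.simps lehmer.simps)
qed

locale pell_type =
  fixes A B C a b :: int
  assumes A: "A > 0" and B: "B > 0" and C: "C \<in> {1, 2, 4}"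
    and sqf: "squarefree A" and par: "even C \<Longrightarrow> odd (A * B)" and A1: "A = 1 \<Longrightarrow> C = 2"
    and min: "smallest_quadratic_solution A B C a b"
begin

definition P :: int where "P = 2 + 4 div C * B * b\<^sup>2"

lemma ab: "a > 0" "b > 0" "A * a\<^sup>2 = B * b\<^sup>2 + C"
  using min by (auto simp: smallest_quadratic_solution_def quadratic_solution_def)

lemma C_pos: "C > 0"
  using C by auto

lemma CP: "C * P = 2 * C + 4 * (B * b\<^sup>2)"
  using C by (auto simp: P_def algebra_simps)

lemma P_ge: "P \<ge> 3"
proof -
  have "4 div C \<ge> 1" "B * b\<^sup>2 \<ge> 1" using C ab B by (auto simp: int_one_le_iff_zero_less)
  then have "1 * 1 \<le> 4 div C * (B * b\<^sup>2)" by (intro mult_mono) auto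
  then show ?thesis by (simp add: P_def mult.assoc)
qed

text \<open>This excludes y = 0 in the descent. A divides C, which forces A = 1, as A is odd when C
  is even; then C = 2 is not a square.\<close>

lemma no_solution_zero: "A * x\<^sup>2 \<noteq> C"
proof
  assume x: "A * x\<^sup>2 = C"
  show False
  proof (cases "A = 1")
    case True
    then have "x\<^sup>2 mod 4 = 2" using x A1 by simp
    then show False using square_mod_4[of x] by simp
  next
    case False
    have "A dvd C" using x by (metis dvd_triv_left)
    have "C \<noteq> 1"
    proof
      assume "C = 1"
      then have "A = 1" using \<open>A dvd C\<close> A by simp
      then show False using False by simp
    qed
    then have "odd A" using par C by auto
    have "A dvd 4" using \<open>A dvd C\<close> C by auto (metis dvd_trans even_numeral dvd_refl numeral_Bit0_eq_double dvd_triv_left)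
    then have "A \<in> {1, 2, 3, 4}" using A zdvd_imp_le[of A 4] by auto
    then show False using \<open>odd A\<close> False \<open>A dvd 4\<close> by auto
  qed
qed

lemma solution_ge:
  assumes "quadratic_solution A B C x y"
  shows "a \<le> x" "b \<le> y"
proof -
  show ax: "a \<le> x" using min assms by (auto simp: smallest_quadratic_solution_def)
  have xy: "x > 0" "y > 0" "A * x\<^sup>2 = B * y\<^sup>2 + C" using assms by (auto simp: quadratic_solution_def)
  have "a\<^sup>2 \<le> x\<^sup>2" using ax ab by (intro power_mono) auto
  then have "A * a\<^sup>2 \<le> A * x\<^sup>2" using A by simp
  then have "B * b\<^sup>2 \<le> B * y\<^sup>2" using ab(3) xy(3) by linarith
  then have "b\<^sup>2 \<le> y\<^sup>2" using B by simp
  then show "b \<le> y" using xy(2) power2_le_imp_le[of b y] by simp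
qed

text \<open>Multiplication by \<open>((a \<surd>A - b \<surd>B)\<^sup>2) / C\<close>.\<close>
lemma descent_integral:
  assumes "A * x\<^sup>2 = B * y\<^sup>2 + C"
  obtains x' y' where "C * x' = x * (C + 2 * (B * b\<^sup>2)) - 2 * a * b * B * y"
    "C * y' = y * (C + 2 * (B * b\<^sup>2)) - 2 * a * b * A * x"
proof -
  consider "C = 1" | "C = 2" | "C = 4" using C by auto
  then show ?thesis
  proof cases
    case 1
    then show ?thesis using that by auto
  next
    case 2
    show ?thesis
      by (rule that[of "x * (1 + B * b\<^sup>2) - a * b * B * y" "y * (1 + B * b\<^sup>2) - a * b * A * x"])
        (simp_all add: 2 algebra_simps)
  next
    case 3
    \<comment> \<open>For C = 4 the coefficients A and B are odd, so a, b and x, y have equal parity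
      in pairs; this supplies the missing factor 2.\<close>
    have odd: "odd A" "odd B" using par 3 by auto
    have "even (A * a\<^sup>2) = even (B * b\<^sup>2)" "even (A * x\<^sup>2) = even (B * y\<^sup>2)"
      using ab(3) assms 3 by auto
    then have par': "even a = even b" "even x = even y" using odd by auto
    then have "even (b * x - a * y)" "even (B * b * y - a * A * x)" using odd by auto
    then obtain m n where "b * x - a * y = 2 * m" "B * b * y - a * A * x = 2 * n"
      unfolding dvd_def by blast
    then have mn: "a * y = b * x - 2 * m" "a * A * x = B * b * y - 2 * n" by simp_all
    have "4 * (x + B * b * m) = x * (4 + 2 * (B * b\<^sup>2)) - 2 * b * B * (a * y)"
      unfolding mn by (simp add: power2_eq_square algebra_simps)
    moreover have "4 * (y + b * n) = y * (4 + 2 * (B * b\<^sup>2)) - 2 * b * (a * A * x)"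
      unfolding mn by (simp add: power2_eq_square algebra_simps)
    ultimately show ?thesis
      by (intro that[of "x + B * b * m" "y + b * n"]) (simp_all add: 3 algebra_simps)
  qed
qed

text \<open>Dividing by t^2 gives y' with -b < y' < y. The value 0 is excluded, and a negative y'
  would give a solution below the smallest one. The last two equations undo the step.\<close>

lemma descent:
  assumes sol: "quadratic_solution A B C x y" and "y \<noteq> b"
  obtains x' y' where "quadratic_solution A B C x' y'" "y' < y"
    "2 * x = P * x' + 4 div C * a * b * B * y'" "2 * y = P * y' + 4 div C * a * b * A * x'"
proof -
  define S where "S = C + 2 * (B * b\<^sup>2)"
  have xy: "x > 0" "y > 0" "A * x\<^sup>2 = B * y\<^sup>2 + C" using sol by (auto simp: quadratic_solution_def)
  have "y > b" using solution_ge[OF sol] assms(2) by simp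
  obtain x' y' where x': "C * x' = x * S - 2 * a * b * B * y" and y': "C * y' = y * S - 2 * a * b * A * x"
    using descent_integral[OF xy(3)] unfolding S_def by blast
  \<comment> \<open>t^2 = (S + 2 a b sqrt(A B)) / C has norm 1.\<close>
  have S: "S\<^sup>2 - 4 * (A * a\<^sup>2) * (B * b\<^sup>2) = C\<^sup>2"
    unfolding ab(3) S_def by (simp add: power2_eq_square algebra_simps)
  have S0: "S > 0" using C_pos B ab by (simp add: S_def add_pos_nonneg)
  have eq': "A * x'\<^sup>2 - B * y'\<^sup>2 = C"
  proof -
    have "C\<^sup>2 * (A * x'\<^sup>2 - B * y'\<^sup>2) = A * (C * x')\<^sup>2 - B * (C * y')\<^sup>2"
      by (simp add: power_mult_distrib algebra_simps)
    also have "\<dots> = (A * x\<^sup>2 - B * y\<^sup>2) * (S\<^sup>2 - 4 * (A * a\<^sup>2) * (B * b\<^sup>2))"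
      unfolding x' y' by (simp add: power2_eq_square algebra_simps)
    also have "\<dots> = C\<^sup>2 * C" unfolding S using xy(3) by simp
    finally show ?thesis using C_pos by simp
  qed
  have x'0: "x' > 0"
  proof -
    have "A * (x * S)\<^sup>2 - A * (2 * a * b * B * y)\<^sup>2
        = (A * x\<^sup>2) * S\<^sup>2 - 4 * (A * a\<^sup>2) * (B * b\<^sup>2) * (B * y\<^sup>2)"
      by (simp add: power2_eq_square algebra_simps)
    also have "\<dots> = C * S\<^sup>2 + (B * y\<^sup>2) * (S\<^sup>2 - 4 * (A * a\<^sup>2) * (B * b\<^sup>2))"
      unfolding xy(3) by (simp add: algebra_simps)
    also have "\<dots> > 0" unfolding S using C_pos S0 B xy by (intro add_pos_nonneg) auto
    finally have "A * (2 * a * b * B * y)\<^sup>2 < A * (x * S)\<^sup>2" by simp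
    then have "(2 * a * b * B * y)\<^sup>2 < (x * S)\<^sup>2" using A by simp
    then have "2 * a * b * B * y < x * S" by (rule power2_less_imp_less) (use xy S0 in auto)
    then have "C * x' > 0" using x' by simp
    then show ?thesis using C_pos by (simp add: zero_less_mult_iff)
  qed
  have "y' < y"
  proof -
    have "(b * B * y)\<^sup>2 < (a * A * x)\<^sup>2"
    proof -
      have "(a * A * x)\<^sup>2 = (A * a\<^sup>2) * (A * x\<^sup>2)" by (simp add: power2_eq_square)
      also have "\<dots> = (b * B * y)\<^sup>2 + C * (B * b\<^sup>2 + B * y\<^sup>2 + C)"
        unfolding xy(3) ab(3) by (simp add: power2_eq_square algebra_simps)
      finally show ?thesis using C_pos B ab xy by (simp add: add_pos_pos)
    qed
    then have "b * B * y < a * A * x" by (rule power2_less_imp_less) (use ab xy A in auto)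
    then have "b * (b * B * y) < b * (a * A * x)" using ab by simp
    then have "C * y' < C * y" using y' by (simp add: S_def power2_eq_square algebra_simps)
    then show ?thesis using C_pos by simp
  qed
  \<comment> \<open>The difference of squares to be compared has the factor y - b, positive because
    y exceeds the smallest b.\<close>
  have "y' > - b"
  proof -
    have "(y * S + C * b)\<^sup>2 - (2 * a * b * A * x)\<^sup>2
        = (y * S + C * b)\<^sup>2 - 4 * b\<^sup>2 * ((A * a\<^sup>2) * (A * x\<^sup>2))"
      by (simp add: power2_eq_square)
    also have "\<dots> = (y - b) * (C\<^sup>2 * (y + 3 * b) + 4 * B * C * (b * b\<^sup>2))"
      unfolding xy(3) ab(3) S_def by (simp add: power2_eq_square algebra_simps)
    also have "\<dots> > 0" using \<open>y > b\<close> ab xy C_pos B by (intro mult_pos_pos add_pos_pos) auto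
    finally have "(2 * a * b * A * x)\<^sup>2 < (y * S + C * b)\<^sup>2" by simp
    then have "2 * a * b * A * x < y * S + C * b"
      by (rule power2_less_imp_less) (use xy S0 C_pos ab in auto)
    then have "C * y' > C * (- b)" using y' by simp
    then show ?thesis using C_pos by (simp only: mult_less_cancel_left_pos)
  qed
  have "y' \<noteq> 0" using eq' no_solution_zero[of x'] by auto
  moreover have "\<not> y' < 0"
  proof
    assume "y' < 0"
    then have "quadratic_solution A B C x' (- y')" using x'0 eq' by (simp add: quadratic_solution_def)
    then show False using solution_ge(2) \<open>y' > - b\<close> by force
  qed
  ultimately have sol': "quadratic_solution A B C x' y'" using x'0 eq' by (simp add: quadratic_solution_def)
  have "C * (4 div C) = 4" using C by auto
  then have m: "4 * t = C * (4 div C * t)" for t by (simp only: mult.assoc[symmetric])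
  have S2: "2 * S = C * P" by (simp add: CP S_def)
  \<comment> \<open>Norm 1 of t^2 inverts the linear substitution that defines x' and y'.\<close>
  have "C * (C * (2 * x)) = C * (2 * S * x' + 4 * (a * b * B * y'))"
  proof -
    have "C * (C * (2 * x)) = 2 * (S\<^sup>2 - 4 * (A * a\<^sup>2) * (B * b\<^sup>2)) * x"
      unfolding S by (simp add: power2_eq_square)
    also have "\<dots> = 2 * S * (C * x') + 4 * (a * b * B) * (C * y')"
      unfolding x' y' by (simp add: power2_eq_square algebra_simps)
    finally show ?thesis by (simp add: algebra_simps)
  qed
  also have "\<dots> = C * (C * (P * x' + 4 div C * a * b * B * y'))"
    unfolding S2 m by (simp add: algebra_simps)
  finally have 1: "2 * x = P * x' + 4 div C * a * b * B * y'" using C_pos by simp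
  have "C * (C * (2 * y)) = C * (2 * S * y' + 4 * (a * b * A * x'))"
  proof -
    have "C * (C * (2 * y)) = 2 * (S\<^sup>2 - 4 * (A * a\<^sup>2) * (B * b\<^sup>2)) * y"
      unfolding S by (simp add: power2_eq_square)
    also have "\<dots> = 2 * S * (C * y') + 4 * (a * b * A) * (C * x')"
      unfolding x' y' by (simp add: power2_eq_square algebra_simps)
    finally show ?thesis by (simp add: algebra_simps)
  qed
  also have "\<dots> = C * (C * (P * y' + 4 div C * a * b * A * x'))"
    unfolding S2 m by (simp add: algebra_simps)
  finally have 2: "2 * y = P * y' + 4 div C * a * b * A * x'" using C_pos by simp
  show ?thesis using that[OF sol' \<open>y' < y\<close> 1 2] .
qed

text \<open>Induction along the descent. As (4 / C) B b^2 = P - 2 and (4 / C) A a^2 = P + 2, the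
  inverse step is the recursion of \<open>co_lehmer\<close> and \<open>lehmer\<close>.\<close>

lemma solutions:
  assumes "quadratic_solution A B C x y"
  shows "\<exists>i. x = a * co_lehmer P i \<and> y = b * lehmer P i"
  using assms
proof (induction "nat y" arbitrary: x y rule: less_induct)
  case less
  have xy: "x > 0" "y > 0" "A * x\<^sup>2 = B * y\<^sup>2 + C"
    using less.prems by (auto simp: quadratic_solution_def)
  show ?case
  proof (cases "y = b")
    case True
    then have "A * x\<^sup>2 = A * a\<^sup>2" using xy(3) ab(3) by simp
    then have "x = a" using A xy(1) ab(1) by simp
    then show ?thesis using True by (intro exI[of _ 0]) simp
  next
    case False
    obtain x' y' where *: "quadratic_solution A B C x' y'" "y' < y"
      "2 * x = P * x' + 4 div C * a * b * B * y'" "2 * y = P * y' + 4 div C * a * b * A * x'"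
      using descent[OF less.prems False] by blast
    have "nat y' < nat y" using *(2) xy(2) by simp
    then obtain i where i: "x' = a * co_lehmer P i" "y' = b * lehmer P i"
      using less.hyps *(1) by blast
    have Bb: "4 div C * (B * b\<^sup>2) = P - 2" by (simp add: P_def mult.assoc)
    have "4 div C * C = 4" using C by auto
    then have Aa: "4 div C * (A * a\<^sup>2) = P + 2"
      unfolding ab(3) distrib_left Bb by simp
    have "2 * x = a * (P * co_lehmer P i + (4 div C * (B * b\<^sup>2)) * lehmer P i)"
      unfolding *(3) i by (simp add: power2_eq_square algebra_simps)
    then have "2 * x = a * (2 * co_lehmer P (Suc i))"
      unfolding Bb using lehmer_co_lehmer[of P i] by simp
    moreover have "2 * y = b * (P * lehmer P i + (4 div C * (A * a\<^sup>2)) * co_lehmer P i)"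
      unfolding *(4) i by (simp add: power2_eq_square algebra_simps)
    then have "2 * y = b * (2 * lehmer P (Suc i))"
      unfolding Aa using lehmer_co_lehmer[of P i] by simp
    ultimately show ?thesis by (intro exI[of _ "Suc i"]) simp
  qed
qed

lemma quartic_unique:
  assumes nsq: "\<not> is_square (4 div C * B * b\<^sup>2 + 3)"
    and "quartic_solution A B C x1 y1" "quartic_solution A B C x2 y2"
  shows "x1 = x2 \<and> y1 = y2"
proof -
  have "quadratic_solution A B C x1 (y1\<^sup>2)" "quadratic_solution A B C x2 (y2\<^sup>2)"
    and pos: "y1 > 0" "y2 > 0"
    using assms(2,3) by (auto simp: quadratic_solution_def quartic_solution_def power_mult[symmetric])
  then obtain i j where i: "x1 = a * co_lehmer P i" "y1\<^sup>2 = b * lehmer P i"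
    and j: "x2 = a * co_lehmer P j" "y2\<^sup>2 = b * lehmer P j"
    using solutions by metis
  have eq: "b\<^sup>2 * (lehmer P i * lehmer P j) = (y1 * y2)\<^sup>2"
    using i(2) j(2) by (simp add: power_mult_distrib power2_eq_square algebra_simps)
  \<comment> \<open>Cancelling b^2 shows that the product of the two Lehmer numbers is itself a
    square.\<close>
  then have "b dvd y1 * y2" by (metis dvd_triv_left pow_divides_pow_iff zero_less_numeral)
  then obtain t where t: "y1 * y2 = b * t" by auto
  have "lehmer P i * lehmer P j = t\<^sup>2"
    using eq ab(2) unfolding t by (simp add: power_mult_distrib)
  moreover have "P + 1 \<noteq> s\<^sup>2" for s
  proof
    assume "P + 1 = s\<^sup>2"
    then have "4 div C * B * b\<^sup>2 + 3 = s\<^sup>2" by (simp add: P_def)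
    then show False using nsq by (metis is_nth_powerI)
  qed
  ultimately have "i = j" using lehmer_mult_square[OF P_ge] by blast
  then have "y1\<^sup>2 = y2\<^sup>2" "x1 = x2" using i j by simp_all
  then show ?thesis using pos by simp
qed

end

theorem theorem2:
  fixes A B C a b :: int
  assumes "A > 0" and "B > 0" and "C \<in> {1, 2, 4}"
    and "squarefree A"
    and "\<not> is_square (A * B)"
    and "even C \<Longrightarrow> odd (A * B)"
    and "A = 1 \<Longrightarrow> C = 2"
    and "\<exists>z1 z2. quadratic_solution A B C z1 z2"
    and "smallest_quadratic_solution A B C a b"
    and "\<not> is_square ((4 div C) * B * b\<^sup>2 + 3)"
  shows "\<exists>\<^sub>\<le>\<^sub>1 p. quartic_solution A B C (fst p) (snd p)"
proof -
  interpret pell_type A B C a b using assms by unfold_locales auto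
  show ?thesis
    using quartic_unique[OF assms(10)] by (auto simp: Uniq_def prod_eq_iff)
qed

end
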